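(* Let $\mathcal{N}_{3,4}$ be the set of all inertias $\operatorname{In}(\rho^\Gamma)$, where $\rho$ ranges over all $12\times 12$ complex positive semidefinite matrices on $\mathbb{C}^3\otimes\mathbb{C}^4$ such that $\rho^\Gamma$ has at least one negative eigenvalue. Then $(6,2,4)\notin\mathcal{N}_{3,4}$, $(6,3,3)\notin\mathcal{N}_{3,4}$ and $(5,4,3)\notin\mathcal{N}_{3,4}$.
   Context: For a Hermitian matrix $H$, the inertia is $\operatorname{In}(H)=(a,b,c)$, where $a,b,c$ are the numbers (with multiplicity) of negative, zero and positive eigenvalues of $H$, in this order. A matrix $M\in\mathbb{C}^{mn\times mn}$ on $\mathbb{C}^m\otimes\mathbb{C}^n$ is written as an $m\times m$ block matrix $M=[M_{ij}]$ with blocks $M_{ij}\in\mathbb{C}^{n\times n}$; its partial transpose (on the first system) is $M^\Gamma=[M_{ji}]$, i.e. the block matrix whose $(i,j)$ block is $M_{ji}$. *)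

theory Defs
  imports "Jordan_Normal_Form.Spectral_Radius"
begin

definition hermitian :: "complex mat \<Rightarrow> bool" where
  "hermitian A \<longleftrightarrow> mat_adjoint A = A"

text \<open>Below, \<open>\<le>\<close> and \<open><\<close> on \<^typ>\<open>complex\<close> are the partial order of \<open>HOL-Library.Complex_Order\<close>:
  comparable numbers have equal imaginary parts, so \<open>0 \<le> z\<close> says that \<open>z\<close> is a nonnegative real.
  The complex number \<open>(A *\<^sub>v v) \<bullet>c v\<close> is \<open>v\<^sup>* A v\<close>.\<close>

definition psd :: "complex mat \<Rightarrow> bool" where
  "psd A \<longleftrightarrow> hermitian A \<and> (\<forall>v \<in> carrier_vec (dim_row A). 0 \<le> (A *\<^sub>v v) \<bullet>c v)"

definition eigenvalues_mset :: "complex mat \<Rightarrow> complex multiset" where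
  "eigenvalues_mset A = proots (char_poly A)"

text \<open>Meaningful for Hermitian \<open>H\<close>, whose eigenvalues are all real; the order is
  (negative, zero, positive).\<close>

definition inertia :: "complex mat \<Rightarrow> nat \<times> nat \<times> nat" where
  "inertia H =
    (size {# x \<in># eigenvalues_mset H. x < 0 #},
     size {# x \<in># eigenvalues_mset H. x = 0 #},
     size {# x \<in># eigenvalues_mset H. 0 < x #})"

text \<open>The \<open>n \<times> n\<close> block of \<open>M\<close> at block position \<open>(i, j)\<close>, with indices starting at \<open>0\<close>.\<close>

definition mat_block :: "nat \<Rightarrow> 'a mat \<Rightarrow> nat \<Rightarrow> nat \<Rightarrow> 'a mat" where
  "mat_block n M i j = mat n n (\<lambda>(k, l). M $$ (i * n + k, j * n + l))"

text \<open>Row index \<open>r\<close> lies in block row \<open>r div n\<close> at offset \<open>r mod n\<close>; likewise for columns.\<close>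

definition partial_transpose :: "nat \<Rightarrow> nat \<Rightarrow> 'a mat \<Rightarrow> 'a mat" where
  "partial_transpose m n M = mat (m * n) (m * n)
     (\<lambda>(r, c). mat_block n M (c div n) (r div n) $$ (r mod n, c mod n))"

lemma mat_block_partial_transpose:
  assumes "i < m" "j < m"
  shows "mat_block n (partial_transpose m n M) i j = mat_block n M j i"
proof -
  have "a * n + b < m * n" if "a < m" "b < n" for a b
  proof -
    have "a * n + b < Suc a * n" using that by simp
    also have "\<dots> \<le> m * n" using that by (intro mult_le_mono1) simp
    finally show ?thesis .
  qed
  then show ?thesis
    using assms by (intro eq_matI) (auto simp: mat_block_def partial_transpose_def)
qed

definition npt_inertias :: "nat \<Rightarrow> nat \<Rightarrow> (nat \<times> nat \<times> nat) set" where
  "npt_inertias m n =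
    {inertia (partial_transpose m n \<rho>) | \<rho>.
       \<rho> \<in> carrier_mat (m * n) (m * n) \<and> psd \<rho> \<and>
       (\<exists>x < 0. eigenvalue (partial_transpose m n \<rho>) x)}"

end

theory Submission
  imports Defs "HOL-Analysis.Cartesian_Space"
begin

text \<open>Let \<open>H\<close> be the partial transpose of \<open>\<rho>\<close> and \<open>W\<close> the orthogonal complement of its positive
  eigenvectors. On a product vector the form of \<open>H\<close> is a value of the form of \<open>\<rho>\<close>, hence
  nonnegative, while on \<open>W\<close> it is negative off the null space \<open>Z\<close> of \<open>H\<close>. So all product vectors of
  \<open>W\<close> lie in \<open>Z\<close>. But if \<open>W\<close> has codimension \<open>3\<close> in \<open>\<complex>\<^sup>3 \<otimes> \<complex>\<^sup>4\<close> its product vectors span at least \<open>5\<close>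
  dimensions, and if it has codimension \<open>4\<close> they span at least \<open>3\<close>. The product vectors come from
  singular members of matrix pencils, that is, from the existence of complex eigenvalues.\<close>

text \<open>\<open>W\<close> enters as the kernel of a linear map \<open>F\<close> into C^3 or C^4.
  For fixed \<open>a\<close> the map \<open>F (tensor a b)\<close> is linear in \<open>b\<close>;
  letting \<open>a\<close> range over a plane of C^3 makes it a pencil, and a singular member is a
  product in \<open>W\<close>. Constraining the plane by a functional keeps \<open>a\<close> away
  from earlier choices. The obstacle is that such products may be too dependent: they may all share
  one second factor \<open>b\<close>, and then they span at most three dimensions, or two if the
  first factors stay in a plane. In codimension 3 this is repaired by pencils on a hyperplane of
  second factors that misses \<open>b\<close>: its dimension 3 still suffices for maps into C^3. In
  codimension 4 the hyperplane is too small for maps into C^4. There the degenerate case is refuted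
  by the rigidity it imposes: relative to a first factor off the plane, the pencil members of the
  plane have 0 as their only eigenvalue and the multiples of \<open>b\<close> as their only
  eigenvectors. The bounds 5 and 3 exceed the numbers of zero eigenvalues in question, which are at
  most 4 with three positive eigenvalues and equal to 2 with four.\<close>

unbundle no vec_syntax
no_notation Matrix.vec_index (infixl "$" 100)
unbundle vec_syntax

section \<open>Singular members of matrix pencils\<close>

abbreviation clinear :: "(complex^'n \<Rightarrow> complex^'p) \<Rightarrow> bool" where
  "clinear \<equiv> Vector_Spaces.linear (*s) (*s)"

lemma clinearI:
  assumes "\<And>x y. f (x + y) = f x + f y" "\<And>c x. f (c *s x) = c *s f x"
  shows "clinear f"
  by unfold_locales (auto simp: assms vec.scale_right_distrib vec.scale_left_distrib)

lemma clinear_simps: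
  assumes "clinear f"
  shows "f (x + y) = f x + f y" "f (x - y) = f x - f y" "f (c *s x) = c *s f x" "f 0 = 0"
    "f (sum g I) = (\<Sum>i\<in>I. f (g i))"
  using assms by (simp_all add: vec.linear_add vec.linear_diff vec.linear_scale vec.linear_0 vec.linear_sum)

text \<open>Stated for indexed families because iterates and product vectors may repeat. A repeated
  vector gives the relation with coefficients 1 and -1.\<close>

lemma dependent_family:
  fixes v :: "'k \<Rightarrow> complex^'n"
  assumes "finite I" "v ` I \<subseteq> S" "vec.dim S < card I"
  shows "\<exists>c. (\<exists>i\<in>I. c i \<noteq> 0) \<and> (\<Sum>i\<in>I. c i *s v i) = 0"
proof (cases "inj_on v I")
  case True
  have "vec.dependent (v ` I)"
    using vec.independent_card_le_dim[OF assms(2)] assms(3) card_image[OF True] by force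
  then obtain u where u: "\<exists>x\<in>v ` I. u x \<noteq> 0" "(\<Sum>x\<in>v ` I. u x *s x) = 0"
    using assms(1) by (auto simp: vec.dependent_finite)
  then have "(\<Sum>i\<in>I. u (v i) *s v i) = 0"
    by (simp add: sum.reindex[OF True] o_def)
  with u(1) show ?thesis by (intro exI[of _ "\<lambda>i. u (v i)"]) auto
next
  case False
  then obtain i j where ij: "i \<in> I" "j \<in> I" "i \<noteq> j" "v i = v j"
    by (auto simp: inj_on_def)
  have "(\<Sum>k\<in>I. (if k = i then 1 else if k = j then - 1 else 0) *s v k)
      = (\<Sum>k\<in>{i, j}. (if k = i then 1 else if k = j then - 1 else 0) *s v k)"
    using assms(1) ij by (intro sum.mono_neutral_right) auto
  also have "\<dots> = 0" using ij by simp
  finally show ?thesis using ij(1)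
    by (intro exI[of _ "\<lambda>k. if k = i then 1 else if k = j then - 1 else 0"]) auto
qed

lemma dependent_3:
  fixes v1 v2 v3 :: "complex^'n"
  assumes "v1 \<in> S" "v2 \<in> S" "v3 \<in> S" "vec.dim S < 3"
  obtains c1 c2 c3 where "c1 \<noteq> 0 \<or> c2 \<noteq> 0 \<or> c3 \<noteq> 0" "c1 *s v1 + c2 *s v2 + c3 *s v3 = 0"
proof -
  let ?v = "\<lambda>i. [v1, v2, v3] ! i"
  have "?v ` {0,1,2} \<subseteq> S" using assms by auto
  from dependent_family[OF _ this] assms(4)
  obtain c where "\<exists>i\<in>{0,1,2}. c i \<noteq> 0" "(\<Sum>i\<in>{0,1,2}. c i *s ?v i) = 0" by auto
  then show ?thesis by (intro that[of "c 0" "c 1" "c 2"]) (auto simp: add.assoc)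
qed

lemma dependent_5:
  fixes v1 v2 v3 v4 v5 :: "complex^'n"
  assumes "v1 \<in> S" "v2 \<in> S" "v3 \<in> S" "v4 \<in> S" "v5 \<in> S" "vec.dim S < 5"
  obtains c1 c2 c3 c4 c5 where "c1 \<noteq> 0 \<or> c2 \<noteq> 0 \<or> c3 \<noteq> 0 \<or> c4 \<noteq> 0 \<or> c5 \<noteq> 0"
    "c1 *s v1 + c2 *s v2 + c3 *s v3 + c4 *s v4 + c5 *s v5 = 0"
proof -
  let ?v = "\<lambda>i. [v1, v2, v3, v4, v5] ! i"
  have "?v ` {0,1,2,3,4} \<subseteq> S" using assms by auto
  from dependent_family[OF _ this] assms(6)
  obtain c where "\<exists>i\<in>{0,1,2,3,4}. c i \<noteq> 0" "(\<Sum>i\<in>{0,1,2,3,4}. c i *s ?v i) = 0" by auto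
  then show ?thesis
    by (intro that[of "c 0" "c 1" "c 2" "c 3" "c 4"]) (auto simp: add.assoc)
qed

text \<open>A root \<open>r\<close> splits \<open>p\<close> as (X - r) q. The vector
  \<open>y = T b - r *s b\<close> is annihilated by q(T) and stays in \<open>S\<close>; either it
  vanishes and \<open>b\<close> is an eigenvector, or the degree has dropped by one.\<close>

lemma eigenvector_of_annihilating_poly:
  fixes T :: "complex^'n \<Rightarrow> complex^'n"
  assumes T: "clinear T" and S: "vec.subspace S" "T ` S \<subseteq> S"
    and "p \<noteq> 0" "b \<in> S" "b \<noteq> 0" "(\<Sum>i\<le>degree p. coeff p i *s (T ^^ i) b) = 0"
  shows "\<exists>x\<in>S. \<exists>\<mu>. x \<noteq> 0 \<and> T x = \<mu> *s x"
  using assms(4-)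
proof (induction "degree p" arbitrary: p b)
  case 0
  then have "coeff p 0 *s b = 0" "coeff p 0 \<noteq> 0" by (auto simp: leading_coeff_0_iff[symmetric])
  with 0 show ?case by simp
next
  case (Suc n)
  have "\<not> constant (poly p)" using Suc by (simp add: constant_degree)
  then obtain r where "poly p r = 0" using fundamental_theorem_of_algebra by blast
  then obtain q where q: "p = [:-r, 1:] * q" by (auto simp: poly_eq_0_iff_dvd)
  have q0: "q \<noteq> 0" using Suc q by auto
  have deg: "degree p = Suc (degree q)" using q0 unfolding q by (subst degree_mult_eq) auto
  have p: "p = pCons 0 q - Polynomial.smult r q" unfolding q by simp
  define y where "y = T b - r *s b"
  have pow: "clinear (T ^^ i)" for i
    by (induction i) (auto intro!: clinearI simp: clinear_simps[OF T] clinear_simps)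
  have "(\<Sum>i\<le>degree p. coeff p i *s (T ^^ i) b) =
      (\<Sum>i\<le>Suc (degree q). coeff (pCons 0 q) i *s (T ^^ i) b) - (\<Sum>i\<le>Suc (degree q). (r * coeff q i) *s (T ^^ i) b)"
    unfolding deg by (subst p) (simp only: coeff_diff Polynomial.coeff_smult vec.scale_left_diff_distrib sum_subtractf)
  also have "(\<Sum>i\<le>Suc (degree q). coeff (pCons 0 q) i *s (T ^^ i) b) = (\<Sum>i\<le>degree q. coeff q i *s (T ^^ i) (T b))"
    unfolding sum.atMost_Suc_shift by (simp add: funpow_swap1)
  also have "(\<Sum>i\<le>Suc (degree q). (r * coeff q i) *s (T ^^ i) b) = (\<Sum>i\<le>degree q. coeff q i *s (T ^^ i) (r *s b))"
    by (auto simp: coeff_eq_0 clinear_simps(3)[OF pow] mult.commute vec.scale_scale)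
  finally have sum0: "(\<Sum>i\<le>degree q. coeff q i *s (T ^^ i) y) = 0"
    using Suc.prems by (simp add: y_def clinear_simps(2)[OF pow] vec.scale_right_diff_distrib sum_subtractf)
  show ?case
  proof (cases "y = 0")
    case True
    then show ?thesis using Suc.prems by (auto simp: y_def)
  next
    case False
    have "y \<in> S" using Suc.prems S by (auto simp: y_def intro!: vec.subspace_diff vec.subspace_scale)
    with False q0 sum0 Suc.hyps deg show ?thesis by auto
  qed
qed

text \<open>The CARD('n) + 1 iterates of \<open>b\<close> are dependent, and the coefficients of the
  relation form an annihilating polynomial. The invariant subspace matters later, as the range of a
  map and as an orthogonal complement.\<close>

lemma eigenvector_in_subspace:
  fixes T :: "complex^'n \<Rightarrow> complex^'n"
  assumes T: "clinear T" and S: "vec.subspace S" "T ` S \<subseteq> S" and b: "b \<in> S" "b \<noteq> 0"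
  obtains x \<mu> where "x \<in> S" "x \<noteq> 0" "T x = \<mu> *s x"
proof -
  let ?I = "{..CARD('n)}"
  have "vec.dim (UNIV :: (complex^'n) set) < card ?I"
    by (simp add: vec.dim_UNIV card_cart_basis)
  from dependent_family[OF _ _ this, of "\<lambda>i. (T ^^ i) b"]
  obtain c where c: "\<exists>i\<in>?I. c i \<noteq> 0" "(\<Sum>i\<in>?I. c i *s (T ^^ i) b) = 0" by auto
  define p where "p = (\<Sum>i\<in>?I. monom (c i) i)"
  have cp: "coeff p i = (if i \<in> ?I then c i else 0)" for i
    by (auto simp: p_def coeff_sum)
  have "p \<noteq> 0" using c(1) cp by (metis coeff_0)
  have "degree p \<le> CARD('n)" by (rule degree_le) (simp add: cp)
  have "(\<Sum>i\<le>degree p. coeff p i *s (T ^^ i) b) = (\<Sum>i\<in>?I. coeff p i *s (T ^^ i) b)"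
    using \<open>degree p \<le> CARD('n)\<close> by (intro sum.mono_neutral_left) (auto simp: coeff_eq_0)
  also have "\<dots> = 0" using c(2) by (simp add: cp)
  finally show ?thesis
    using eigenvector_of_annihilating_poly[OF T S \<open>p \<noteq> 0\<close> b] that by blast
qed

text \<open>If \<open>L1\<close> is not injective on \<open>B\<close>, it is itself singular.
  Otherwise the dimensions force \<open>L1\<close> to map \<open>B\<close> onto \<open>Y\<close>, so
  \<open>L1\<close> can be inverted there by \<open>G\<close>, and an eigenvector of
  \<open>G \<circ> L2\<close> in \<open>B\<close> is killed by \<open>L2\<close> minus the
  eigenvalue times \<open>L1\<close>.\<close>

lemma pencil_singular:
  fixes L1 L2 :: "complex^'n \<Rightarrow> complex^'p"
  assumes L: "clinear L1" "clinear L2"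
    and B: "vec.subspace B" "b \<in> B" "b \<noteq> 0"
    and Y: "vec.subspace Y" "L1 ` B \<subseteq> Y" "L2 ` B \<subseteq> Y" "vec.dim Y \<le> vec.dim B"
  obtains s t x where "s \<noteq> 0 \<or> t \<noteq> 0" "x \<in> B" "x \<noteq> 0" "s *s L1 x + t *s L2 x = 0"
proof (cases "inj_on L1 B")
  case False
  then obtain x y where "x \<in> B" "y \<in> B" "x \<noteq> y" "L1 x = L1 y" by (auto simp: inj_on_def)
  then show ?thesis
    using that[of 1 0 "x - y"] B by (auto simp: clinear_simps[OF L(1)] vec.subspace_diff)
next
  case True
  have span: "vec.span B = B" using B(1) by (simp add: vec.span_eq_iff)
  have "vec.dim (L1 ` B) = vec.dim B"
    using True L(1) by (intro vec.dim_image_eq) (auto simp: span)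
  moreover have sub: "vec.subspace (L1 ` B)" using L(1) B(1) by (rule vec.linear_subspace_image)
  ultimately have img: "L1 ` B = Y" using Y by (intro vec.subspace_dim_equal) auto
  obtain G where G: "clinear G" "\<And>x. x \<in> B \<Longrightarrow> G (L1 x) = x" "range G \<subseteq> B"
    using vec.linear_exists_left_inverse_on[OF L(1) B(1) True] span by auto
  have GL: "clinear (G \<circ> L2)" by (rule clinearI) (simp_all add: clinear_simps[OF L(2)] clinear_simps[OF G(1)])
  obtain x \<mu> where x: "x \<in> B" "x \<noteq> 0" "(G \<circ> L2) x = \<mu> *s x"
  proof (rule eigenvector_in_subspace[OF GL B(1) _ B(2,3)])
    show "(G \<circ> L2) ` B \<subseteq> B" using G(3) by auto
  qed
  obtain y where y: "y \<in> B" "L2 x = L1 y" using img Y(3) x(1) by blast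
  then have "y = \<mu> *s x" using x(3) G(2) by simp
  then have "L2 x = \<mu> *s L1 x" using y by (simp add: clinear_simps[OF L(1)])
  then show ?thesis using that[of "- \<mu>" 1 x] x by simp
qed

section \<open>Product vectors in the kernel of a linear map\<close>

text \<open>Bilinear, without conjugation: \<open>dot \<phi>\<close> runs through the linear
  functionals. The Hermitian inner product is \<open>cip\<close>.\<close>

definition dot :: "complex^'n \<Rightarrow> complex^'n \<Rightarrow> complex" where
  "dot \<phi> x = (\<Sum>i\<in>UNIV. \<phi> $ i * x $ i)"

lemma dot_simps [simp]:
  "dot \<phi> (x + y) = dot \<phi> x + dot \<phi> y" "dot \<phi> (x - y) = dot \<phi> x - dot \<phi> y"
  "dot \<phi> (c *s x) = c * dot \<phi> x" "dot \<phi> 0 = 0"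
  "dot (\<phi> + \<psi>) x = dot \<phi> x + dot \<psi> x"
  by (simp_all add: dot_def sum.distrib sum_subtractf sum_distrib_left algebra_simps)

lemma subspace_dot_kernel: "vec.subspace {x. dot \<phi> x = 0}"
  by (auto intro!: vec.subspaceI)

lemma separating_functional:
  assumes S: "vec.subspace S" and x: "x \<notin> S"
  obtains \<phi> where "\<And>y. y \<in> S \<Longrightarrow> dot \<phi> y = 0" "dot \<phi> x \<noteq> 0"
proof -
  obtain B where B: "B \<subseteq> S" "vec.independent B" "S \<subseteq> vec.span B"
    by (rule vec.basis_exists)
  have span: "vec.span B = S" using B S by (metis vec.span_subspace)
  have "vec.independent (insert x B)" using B(2) x span by (simp add: vec.independent_insert)
  \<comment> \<open>A functional appears here as a map into \<open>complex^1\<close>; its values on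
    the unit vectors are the entries of \<open>\<phi>\<close>.\<close>
  then obtain g :: "complex^'a \<Rightarrow> complex^1"
    where g: "clinear g" "\<forall>y\<in>insert x B. g y = (if y = x then axis 1 1 else 0)"
    using vec.linear_independent_extend[of "insert x B" "\<lambda>y. if y = x then axis 1 1 else 0"] by blast
  have g0: "g y = 0" if "y \<in> S" for y
    using vec.linear_eq_0_on_span[OF g(1), of B y] that span g(2) x B(1) by fastforce
  define \<phi> where "\<phi> = (\<chi> i. g (axis i 1) $ 1)"
  have "dot \<phi> y = g y $ 1" for y
    using Cartesian_Space.linear_componentwise[OF g(1), of y 1] by (simp add: dot_def \<phi>_def mult.commute)
  then show ?thesis using that[of \<phi>] g0 g(2) by (simp add: axis_def)
qed

lemma nonzero_functional:
  assumes "x \<noteq> 0"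
  obtains \<phi> where "dot \<phi> x \<noteq> 0"
  using separating_functional[of "{0}" x] assms by (auto simp: vec.subspace_0)

text \<open>Given functionals nonzero at \<open>x\<close> and at \<open>y\<close> respectively, one
  of the two or their sum is nonzero at both.\<close>

lemma nonzero_functional_2:
  assumes "x \<noteq> 0" "y \<noteq> 0"
  obtains \<phi> where "dot \<phi> x \<noteq> 0" "dot \<phi> y \<noteq> 0"
proof -
  obtain \<phi> \<psi> where *: "dot \<phi> x \<noteq> 0" "dot \<psi> y \<noteq> 0"
    using assms nonzero_functional by metis
  show ?thesis
    using that[of \<phi>] that[of \<psi>] that[of "\<phi> + \<psi>"] * by (cases "dot \<phi> y = 0"; cases "dot \<psi> x = 0") auto
qed

lemma separating_functional_line:
  assumes "\<And>c. x \<noteq> c *s y"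
  obtains \<phi> where "dot \<phi> y = 0" "dot \<phi> x \<noteq> 0"
proof -
  have "x \<notin> vec.span {y}" using assms by (auto simp: vec.span_singleton)
  then show ?thesis
    using separating_functional[OF vec.subspace_span] that by (metis singletonI vec.span_base)
qed

lemma dim_dot_kernel: "CARD('n) \<le> Suc (vec.dim {x :: complex^'n. dot \<phi> x = 0})"
proof (cases "\<exists>x. dot \<phi> x \<noteq> 0")
  case True
  then obtain x where x: "dot \<phi> x \<noteq> 0" by blast
  let ?K = "{x. dot \<phi> x = 0}"
  have "y \<in> vec.span (insert x ?K)" for y
  proof -
    have "y - (dot \<phi> y / dot \<phi> x) *s x \<in> vec.span ?K"
      using x by (intro vec.span_base) simp
    then show ?thesis unfolding vec.span_insert by blast
  qed
  then have "vec.dim (UNIV :: (complex^'n) set) \<le> vec.dim (insert x ?K)"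
    by (intro vec.dim_mono) auto
  also have "\<dots> \<le> Suc (vec.dim ?K)" by (simp add: vec.dim_insert)
  finally show ?thesis by (simp add: vec.dim_UNIV card_cart_basis)
next
  case False
  then have "{x. dot \<phi> x = 0} = UNIV" by auto
  then show ?thesis by (simp only: vec.dim_UNIV) (simp add: card_cart_basis)
qed

lemma two_independent:
  assumes "2 \<le> vec.dim S"
  obtains u v :: "complex^'n" where "u \<in> S" "v \<in> S" "\<And>s t. s *s u + t *s v = 0 \<Longrightarrow> s = 0 \<and> t = 0"
proof -
  have "vec.dim S \<noteq> 0" using assms by linarith
  then obtain u where u: "u \<in> S" "u \<noteq> 0" unfolding vec.dim_eq_0 by blast
  have "\<not> S \<subseteq> vec.span {u}"
    using vec.dim_le_card[of S "{u}"] assms by auto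
  then obtain v where v: "v \<in> S" "v \<notin> vec.span {u}" by blast
  have "s = 0 \<and> t = 0" if st: "s *s u + t *s v = 0" for s t
  proof -
    have "t = 0"
    proof (rule ccontr)
      assume "t \<noteq> 0"
      have "t *s v = (- s) *s u" using st by (simp add: add_eq_0_iff2)
      then have "inverse t *s (t *s v) = inverse t *s ((- s) *s u)" by simp
      then have "v = (inverse t * (- s)) *s u" using \<open>t \<noteq> 0\<close> by (simp only: vec.scale_scale) simp
      with v(2) show False by (metis singletonI vec.span_base vec.span_scale)
    qed
    with st u(2) show ?thesis by simp
  qed
  with u(1) v(1) show ?thesis using that by blast
qed

section \<open>Product vectors and contraction of the first factor\<close>

definition tensor :: "complex^'m \<Rightarrow> complex^'n \<Rightarrow> complex^('m \<times> 'n)" where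
  "tensor a b = (\<chi> ij. a $ fst ij * b $ snd ij)"

lemma tensor_simps:
  "tensor (a + a') b = tensor a b + tensor a' b" "tensor a (b + b') = tensor a b + tensor a b'"
  "tensor (c *s a) b = c *s tensor a b" "tensor a (c *s b) = c *s tensor a b"
  "tensor (a - a') b = tensor a b - tensor a' b" "tensor a (b - b') = tensor a b - tensor a b'"
  "tensor 0 b = 0" "tensor a 0 = 0"
  by (simp_all add: tensor_def vec_eq_iff algebra_simps)

text \<open>The map \<phi> \<otimes> id. Applied to a relation between products it yields a relation
  between second factors, and it drops every product whose first factor is killed by \<phi>.\<close>

definition contract :: "complex^'m \<Rightarrow> complex^('m \<times> 'n) \<Rightarrow> complex^'n" where
  "contract \<phi> z = (\<chi> j. \<Sum>i\<in>UNIV. \<phi> $ i * z $ (i, j))"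

lemma contract_simps [simp]:
  "contract \<phi> (x + y) = contract \<phi> x + contract \<phi> y" "contract \<phi> (c *s x) = c *s contract \<phi> x"
  "contract \<phi> 0 = 0" "contract \<phi> (tensor a b) = dot \<phi> a *s b"
  by (simp_all add: contract_def dot_def tensor_def vec_eq_iff sum.distrib sum_distrib_left sum_distrib_right algebra_simps)

lemma clinear_tensor:
  assumes "clinear F"
  shows "clinear (\<lambda>b. F (tensor a b))"
  by (rule clinearI) (simp_all add: tensor_simps clinear_simps[OF assms])

text \<open>The kernel of \<open>dot \<phi>\<close> in C^3 contains a plane spanned by independent
  \<open>u\<close>, \<open>v\<close>. The maps \<open>F (tensor u x)\<close> and
  \<open>F (tensor v x)\<close> on \<open>B\<close> form a pencil into a space no larger than
  \<open>B\<close>; a singular member with coefficients \<open>s\<close>, \<open>t\<close> gives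
  \<open>a = s *s u + t *s v\<close>, nonzero by independence. Taking \<open>\<phi> = 0\<close>
  imposes no condition on \<open>a\<close>.\<close>

lemma product_in_kernel:
  fixes F :: "complex^(3 \<times> 'n::finite) \<Rightarrow> complex^'p"
  assumes F: "clinear F" and B: "vec.subspace B" and dim: "CARD('p) \<le> vec.dim B"
  obtains a b where "a \<noteq> 0" "dot \<phi> a = 0" "b \<in> B" "b \<noteq> 0" "F (tensor a b) = 0"
proof -
  have "2 \<le> vec.dim {x :: complex^3. dot \<phi> x = 0}" using dim_dot_kernel[of \<phi>] by simp
  then obtain u v where uv: "dot \<phi> u = 0" "dot \<phi> v = 0" "\<And>s t. s *s u + t *s v = 0 \<Longrightarrow> s = 0 \<and> t = 0"
    by (rule two_independent) auto
  have "0 < CARD('p)" by simp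
  then have "vec.dim B \<noteq> 0" using dim by linarith
  then obtain b where b: "b \<in> B" "b \<noteq> 0" unfolding vec.dim_eq_0 by blast
  have "vec.dim (UNIV :: (complex^'p) set) \<le> vec.dim B" using dim by (simp add: vec.dim_UNIV card_cart_basis)
  then obtain s t x where *: "s \<noteq> 0 \<or> t \<noteq> 0" "x \<in> B" "x \<noteq> 0" "s *s F (tensor u x) + t *s F (tensor v x) = 0"
    using pencil_singular[OF clinear_tensor[OF F, of u] clinear_tensor[OF F, of v] B b vec.subspace_UNIV]
    by auto
  have "F (tensor (s *s u + t *s v) x) = 0" using *(4) by (simp add: tensor_simps clinear_simps[OF F])
  then show ?thesis using that[of "s *s u + t *s v" x] * uv by auto
qed

lemma axis_nth: "axis i x $ j = (if j = i then x else 0)"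
  by (simp add: axis_def)

lemma dot_axis [simp]: "dot (axis i 1) x = x $ i"
  by (simp add: dot_def axis_nth if_distrib[of "\<lambda>c. c * _"] cong: if_cong)

lemma subspace_scale_cancel:
  assumes "vec.subspace S" "c \<noteq> 0" "c *s x \<in> S"
  shows "x \<in> S"
proof -
  have "inverse c *s (c *s x) \<in> S" using assms(1,3) by (rule vec.subspace_scale)
  moreover have "inverse c *s (c *s x) = x" using assms(2) by (simp add: vec_eq_iff)
  ultimately show ?thesis by simp
qed

section \<open>Codimension three: products in the kernel of a map into
  \<open>complex^3\<close>\<close>

lemma nontrivial_kernel:
  fixes f :: "complex^'n \<Rightarrow> complex^'p"
  assumes f: "clinear f" and "CARD('p) < CARD('n)"
  obtains x where "x \<noteq> 0" "f x = 0"
proof -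
  have "\<not> inj f"
  proof
    assume "inj f"
    then have "vec.dim (range f) = vec.dim (UNIV :: (complex^'n) set)"
      using f by (intro vec.dim_image_eq) auto
    moreover have "vec.dim (range f) \<le> vec.dim (UNIV :: (complex^'p) set)" by (rule vec.dim_subset) simp
    ultimately show False using assms(2) by (simp add: vec.dim_UNIV card_cart_basis)
  qed
  then obtain x y where "x \<noteq> y" "f x = f y" by (auto simp: inj_on_def)
  then show ?thesis using that[of "x - y"] by (simp add: clinear_simps[OF f])
qed

text \<open>If there is no such \<open>b\<close>, then products whose first factors are the unit vectors and \<open>(1, 1, 1)\<close>
  form a basis of \<open>Z\<close>, and expanding products with first factors \<open>(1, 2, 3)\<close> and \<open>(1, 1, 0)\<close> in
  this basis gives incompatible equations for the second factors.\<close>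

lemma common_second_factor:
  fixes Z :: "(complex^(3 \<times> 4)) set"
  assumes Z: "vec.subspace Z" "vec.dim Z < 5" and ex: "\<And>a. \<exists>b. b \<noteq> 0 \<and> tensor a b \<in> Z"
  shows "\<exists>b. b \<noteq> 0 \<and> (\<forall>a. tensor a b \<in> Z)"
proof (rule ccontr)
  assume neg: "\<not> ?thesis"
  define e :: "3 \<Rightarrow> complex^3" where "e i = axis i 1" for i
  have e: "a = a $ 1 *s e 1 + a $ 2 *s e 2 + a $ 3 *s e 3" for a
    by (simp add: vec_eq_iff forall_3 e_def axis_nth)
  have slice: "dot (axis 1 1) (e 1) = 1" "dot (axis 1 1) (e 2) = 0" "dot (axis 1 1) (e 3) = 0"
     "dot (axis 2 1) (e 1) = 0" "dot (axis 2 1) (e 2) = 1" "dot (axis 2 1) (e 3) = 0"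
     "dot (axis 3 1) (e 1) = 0" "dot (axis 3 1) (e 2) = 0" "dot (axis 3 1) (e 3) = 1"
    by (simp_all add: e_def axis_nth)
  note closed = vec.subspace_add[OF Z(1)] vec.subspace_diff[OF Z(1)] vec.subspace_scale[OF Z(1)]
  have no: False if "b \<noteq> 0" "tensor (e 1) b \<in> Z" "tensor (e 2) b \<in> Z" "tensor (e 3) b \<in> Z" for b
  proof -
    have "tensor a b \<in> Z" for a
      by (subst e[of a]) (use that in \<open>auto simp: tensor_simps intro!: closed\<close>)
    with neg that(1) show False by blast
  qed
  define u where "u = e 1 + e 2 + e 3"
  obtain g where g: "\<And>a. g a \<noteq> 0" "\<And>a. tensor a (g a) \<in> Z" using ex by metis
  define b1 b2 b3 b where "b1 = g (e 1)" and "b2 = g (e 2)" and "b3 = g (e 3)" and "b = g u"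
  have b0: "b1 \<noteq> 0" "b2 \<noteq> 0" "b3 \<noteq> 0" "b \<noteq> 0"
    and bZ: "tensor (e 1) b1 \<in> Z" "tensor (e 2) b2 \<in> Z" "tensor (e 3) b3 \<in> Z" "tensor u b \<in> Z"
    unfolding b1_def b2_def b3_def b_def by (rule g)+
  have u: "tensor u x = tensor (e 1) x + tensor (e 2) x + tensor (e 3) x" for x :: "complex^4"
    by (simp add: u_def tensor_simps)
  have mem: "tensor a x \<in> Z" if "c *s x = d *s y" "c \<noteq> 0" "tensor a y \<in> Z" for a c d x y
  proof (rule subspace_scale_cancel[OF Z(1) that(2)])
    have "c *s tensor a x = d *s tensor a y" by (simp only: that(1) tensor_simps(4)[symmetric])
    then show "c *s tensor a x \<in> Z" using closed(3)[OF that(3)] by simp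
  qed
  \<comment> \<open>Since \<open>tensor u b\<close> is in \<open>Z\<close> and is the sum of the
    three slices, two slices in \<open>Z\<close> force the remaining one.\<close>
  have two: False if "tensor (e 1) b \<in> Z \<and> tensor (e 2) b \<in> Z \<or> tensor (e 1) b \<in> Z \<and> tensor (e 3) b \<in> Z
      \<or> tensor (e 2) b \<in> Z \<and> tensor (e 3) b \<in> Z"
  proof -
    have third: "z - x - y \<in> Z" if "z \<in> Z" "x \<in> Z" "y \<in> Z" for x y z using that closed(2) by blast
    have "tensor u b - tensor (e 1) b - tensor (e 2) b = tensor (e 3) b"
      "tensor u b - tensor (e 1) b - tensor (e 3) b = tensor (e 2) b"
      "tensor u b - tensor (e 2) b - tensor (e 3) b = tensor (e 1) b"
      by (simp_all add: u)
    then have "tensor (e 1) b \<in> Z \<and> tensor (e 2) b \<in> Z \<and> tensor (e 3) b \<in> Z"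
      using that third[OF bZ(4)] by metis
    then show False using no[OF b0(4)] by blast
  qed
  \<comment> \<open>Five products in a space of dimension below 5 are dependent; reading the
    relation in each of the three slices gives one equation per coordinate of \<open>a\<close>. The
    coefficient \<open>c\<close> of \<open>b\<close> is the same in all three because
    \<open>b\<close> comes from the first factor (1, 1, 1).\<close>
  have key: "\<exists>c1 c2 c3 c. a $ 1 *s y = c1 *s b1 + c *s b \<and> a $ 2 *s y = c2 *s b2 + c *s b \<and> a $ 3 *s y = c3 *s b3 + c *s b"
    if ay: "tensor a y \<in> Z" for a y
  proof -
    obtain k1 k2 k3 k l where k: "k1 \<noteq> 0 \<or> k2 \<noteq> 0 \<or> k3 \<noteq> 0 \<or> k \<noteq> 0 \<or> l \<noteq> 0"
      and sum: "k1 *s tensor (e 1) b1 + k2 *s tensor (e 2) b2 + k3 *s tensor (e 3) b3 + k *s tensor u b + l *s tensor a y = 0"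
      using dependent_5[OF bZ ay Z(2)] .
    have eqs: "k1 *s b1 + k *s b + (l * a $ 1) *s y = 0" "k2 *s b2 + k *s b + (l * a $ 2) *s y = 0"
      "k3 *s b3 + k *s b + (l * a $ 3) *s y = 0"
      using arg_cong[OF sum, of "contract (axis 1 1)"] arg_cong[OF sum, of "contract (axis 2 1)"]
        arg_cong[OF sum, of "contract (axis 3 1)"]
      by (simp_all add: u slice del: dot_axis) (simp_all add: vec.scale_scale)
    \<comment> \<open>A relation among the four basis candidates alone would make \<open>b\<close>
      parallel to each of \<open>b1\<close>, \<open>b2\<close>, \<open>b3\<close>, hence a common
      second factor.\<close>
    have "l \<noteq> 0"
    proof
      assume l: "l = 0"
      have "k \<noteq> 0" using eqs l k b0 by auto
      moreover have "k *s b = (- k1) *s b1" "k *s b = (- k2) *s b2" "k *s b = (- k3) *s b3"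
        using eqs l by (auto simp: add_eq_0_iff)
      ultimately show False using no[OF b0(4)] mem[OF _ _ bZ(1)] mem[OF _ _ bZ(2)] mem[OF _ _ bZ(3)] by blast
    qed
    have "x *s y = (- k1 / l) *s b1 + (- k / l) *s b" if "k1 *s b1 + k *s b + (l * x) *s y = 0" for x k1 b1
    proof (subst vec_eq_iff, intro allI)
      fix j
      have "k1 * b1 $ j + k * b $ j + l * x * y $ j = 0" using arg_cong[OF that, of "\<lambda>z. z $ j"] by simp
      then have "x * y $ j * l = - (k1 * b1 $ j + k * b $ j)" by (simp add: eq_neg_iff_add_eq_0 algebra_simps)
      then have "x * y $ j = - (k1 * b1 $ j + k * b $ j) / l" using \<open>l \<noteq> 0\<close> by (simp add: eq_divide_eq)
      then show "(x *s y) $ j = ((- k1 / l) *s b1 + (- k / l) *s b) $ j" by (simp add: add_divide_distrib diff_divide_distrib)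
    qed
    with eqs show ?thesis by blast
  qed
  \<comment> \<open>The coordinates 1, 2, 3 are nonzero and distinct: nonzero so that
    \<open>c = 0\<close> would make \<open>y\<close> a common second factor, distinct so that at
    most one of \<open>k\<close>, \<open>2 * k\<close>, \<open>3 * k\<close> equals \<open>c\<close>
    when \<open>y = k *s b\<close>.\<close>
  obtain y where y: "y \<noteq> 0" "tensor (e 1 + 2 *s e 2 + 3 *s e 3) y \<in> Z" using ex by blast
  obtain c1 c2 c3 c where c: "y = c1 *s b1 + c *s b" "2 *s y = c2 *s b2 + c *s b" "3 *s y = c3 *s b3 + c *s b"
    using key[OF y(2)] by (auto simp: e_def axis_nth)
  have "c \<noteq> 0"
  proof
    assume "c = 0"
    then have "1 *s y = c1 *s b1" "2 *s y = c2 *s b2" "3 *s y = c3 *s b3" using c by simp_all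
    then show False
      using no[OF y(1)] mem[OF _ one_neq_zero bZ(1)] mem[OF _ zero_neq_numeral[symmetric] bZ(2)]
        mem[OF _ zero_neq_numeral[symmetric] bZ(3)] by blast
  qed
  show False
  proof (cases "\<exists>k. y = k *s b")
    case True
    then obtain k where k: "y = k *s b" by blast
    have "k \<noteq> 0" using k y(1) by auto
    have m: "(m * k - c) *s b = z" if "m *s y = z + c *s b" for m z
      using that unfolding k by (simp add: vec_eq_iff left_diff_distrib diff_eq_eq mult.assoc)
    have "(k - c) *s b = c1 *s b1" "(2 * k - c) *s b = c2 *s b2" "(3 * k - c) *s b = c3 *s b3"
      using m[of 1] m[of 2] m[of 3] c by simp_all
    then have "k \<noteq> c \<Longrightarrow> tensor (e 1) b \<in> Z" "2 * k \<noteq> c \<Longrightarrow> tensor (e 2) b \<in> Z" "3 * k \<noteq> c \<Longrightarrow> tensor (e 3) b \<in> Z"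
      using mem[OF _ _ bZ(1)] mem[OF _ _ bZ(2)] mem[OF _ _ bZ(3)] by simp_all
    then show False using two \<open>k \<noteq> 0\<close> by (cases "k = c"; cases "2 * k = c") auto
  next
    case False
    then obtain \<phi> where \<phi>: "dot \<phi> b = 0" "dot \<phi> y \<noteq> 0" using separating_functional_line by metis
    have "b \<noteq> k *s y" for k
    proof
      assume "b = k *s y"
      then have "y = inverse k *s b" using b0(4) by (auto simp: vec.scale_scale)
      with False show False by blast
    qed
    then obtain \<psi> where \<psi>: "dot \<psi> y = 0" "dot \<psi> b \<noteq> 0" using separating_functional_line by metis
    \<comment> \<open>The zero third coordinate of (1, 1, 0) gives a relation between
      \<open>b3\<close> and \<open>b\<close> alone, and \<open>\<phi>\<close> shows that it is
      trivial. So the coefficient \<open>d\<close> of \<open>b\<close> vanishes and \<open>x\<close>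
      is a multiple of both \<open>b1\<close> and \<open>b2\<close>.\<close>
    obtain x where x: "x \<noteq> 0" "tensor (e 1 + e 2) x \<in> Z" using ex by blast
    have coords: "(e 1 + e 2) $ 1 = 1" "(e 1 + e 2) $ 2 = 1" "(e 1 + e 2) $ 3 = 0"
      by (simp_all add: e_def axis_nth)
    obtain d1 d2 d3 d
      where d: "x = d1 *s b1 + d *s b" "x = d2 *s b2 + d *s b" "0 = d3 *s b3 + d *s b"
      using key[OF x(2)] unfolding coords vec.scale_one vec.scale_zero_left by blast
    have p: "dot \<phi> y = c1 * dot \<phi> b1" "2 * dot \<phi> y = c2 * dot \<phi> b2" "3 * dot \<phi> y = c3 * dot \<phi> b3"
      using arg_cong[OF c(1), of "dot \<phi>"] arg_cong[OF c(2), of "dot \<phi>"] arg_cong[OF c(3), of "dot \<phi>"] \<phi>(1) by simp_all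
    have q: "0 = c1 * dot \<psi> b1 + c * dot \<psi> b" "0 = c2 * dot \<psi> b2 + c * dot \<psi> b"
      using arg_cong[OF c(1), of "dot \<psi>"] arg_cong[OF c(2), of "dot \<psi>"] \<psi>(1) by simp_all
    have "d3 * dot \<phi> b3 = 0" using arg_cong[OF d(3), of "dot \<phi>"] \<phi>(1) by simp
    then have "d3 = 0" using p(3) \<phi>(2) by auto
    then have "d = 0" using d(3) b0(4) by simp
    then have d12: "x = d1 *s b1" "d1 *s b1 = d2 *s b2" using d by auto
    have r: "d1 * dot \<phi> b1 = d2 * dot \<phi> b2" "d1 * dot \<psi> b1 = d2 * dot \<psi> b2"
      using arg_cong[OF d12(2), of "dot \<phi>"] arg_cong[OF d12(2), of "dot \<psi>"] by simp_all
    have nz: "c1 \<noteq> 0" "c2 \<noteq> 0" using p \<phi>(2) by auto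
    \<comment> \<open>Two values for the ratio of \<open>d1 * c2\<close> to \<open>d2 * c1\<close>:
      measured by \<open>\<phi>\<close>, which kills \<open>b\<close>, it is 2, the ratio of the
      first two coordinates of (1, 2, 3); measured by \<open>\<psi>\<close>, which kills
      \<open>y\<close>, it is 1. Hence \<open>d1 * c2 = 0\<close>.\<close>
    have "d1 * c2 * dot \<phi> y = d2 * c1 * (2 * dot \<phi> y)"
    proof -
      have "d1 * c2 * dot \<phi> y = c1 * c2 * (d1 * dot \<phi> b1)" by (simp add: p(1))
      also have "\<dots> = d2 * c1 * (c2 * dot \<phi> b2)" by (simp add: r(1))
      finally show ?thesis by (simp only: p(2))
    qed
    then have "d1 * c2 = 2 * (d2 * c1)" using \<phi>(2) by simp
    moreover have "d1 * c2 = d2 * c1"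
    proof -
      have "d1 * c2 * (c * dot \<psi> b) = - (c1 * c2 * (d1 * dot \<psi> b1))" using q(1) by (simp add: add_eq_0_iff algebra_simps)
      also have "\<dots> = d2 * c1 * (- (c2 * dot \<psi> b2))" using r(2) by simp
      also have "\<dots> = d2 * c1 * (c * dot \<psi> b)" using q(2) by (simp add: add_eq_0_iff)
      finally show ?thesis using \<open>c \<noteq> 0\<close> \<psi>(2) by simp
    qed
    ultimately have "d1 * c2 = 0" by simp
    then show False using nz d12(1) x(1) by simp
  qed
qed

text \<open>Every \<open>a\<close> has a partner \<open>b\<close>, since 4 > 3. If all these
  products lay in a \<open>Z\<close> of dimension below 5, some \<open>b\<close> would serve for
  every \<open>a\<close>, filling three dimensions of \<open>Z\<close>. Two further independent
  products, with second factors in a hyperplane that misses \<open>b\<close>, make five.\<close>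

lemma kernel_products_span_5:
  fixes F :: "complex^(3 \<times> 4) \<Rightarrow> complex^3"
  assumes F: "clinear F" and Z: "vec.subspace Z" "vec.dim Z < 5"
  obtains a b where "F (tensor a b) = 0" "tensor a b \<notin> Z"
proof (rule ccontr)
  assume neg: "\<not> thesis"
  note obt = that
  have mem: "tensor a b \<in> Z" if "F (tensor a b) = 0" for a b
    using obt[OF that] neg by blast
  have "\<exists>b. b \<noteq> 0 \<and> tensor a b \<in> Z" for a
  proof -
    have "CARD(3) < CARD(4)" by simp
    then obtain b where "b \<noteq> 0" "F (tensor a b) = 0"
      using nontrivial_kernel[OF clinear_tensor[OF F, of a]] by blast
    then show ?thesis using mem by blast
  qed
  then obtain b where b: "b \<noteq> 0" "\<And>a. tensor a b \<in> Z"
    using common_second_factor[OF Z] by blast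
  obtain \<phi> where \<phi>: "dot \<phi> b \<noteq> 0" using nonzero_functional[OF b(1)] .
  \<comment> \<open>A complement of the line through \<open>b\<close>; its dimension 3 is just
    enough for \<open>product_in_kernel\<close> with values in \<open>complex^3\<close>.\<close>
  let ?B = "{x. dot \<phi> x = 0}"
  have dim: "CARD(3) \<le> vec.dim ?B" using dim_dot_kernel[of \<phi>] by simp
  note product = product_in_kernel[OF F subspace_dot_kernel dim]
  obtain a c where "a \<noteq> 0" "dot 0 a = 0" "c \<in> ?B" "c \<noteq> 0" "F (tensor a c) = 0"
    by (rule product)
  then have ac: "a \<noteq> 0" "c \<noteq> 0" "dot \<phi> c = 0" "tensor a c \<in> Z" using mem by auto
  obtain \<psi> where \<psi>: "dot \<psi> a \<noteq> 0" using nonzero_functional[OF ac(1)] .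
  obtain a' c' where "a' \<noteq> 0" "dot \<psi> a' = 0" "c' \<in> ?B" "c' \<noteq> 0" "F (tensor a' c') = 0"
    by (rule product)
  then have ac': "a' \<noteq> 0" "c' \<noteq> 0" "dot \<psi> a' = 0" "dot \<phi> c' = 0" "tensor a' c' \<in> Z" using mem by auto
  obtain k1 k2 k3 l l' where k: "k1 \<noteq> 0 \<or> k2 \<noteq> 0 \<or> k3 \<noteq> 0 \<or> l \<noteq> 0 \<or> l' \<noteq> 0"
    and sum: "k1 *s tensor (axis 1 1) b + k2 *s tensor (axis 2 1) b + k3 *s tensor (axis 3 1) b
      + l *s tensor a c + l' *s tensor a' c' = 0"
    using dependent_5[OF b(2) b(2) b(2) ac(4) ac'(5) Z(2)] .
  \<comment> \<open>Applying \<open>\<phi>\<close> to the second factor kills \<open>c\<close> and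
    \<open>c'\<close>; what remains of slice i is a nonzero multiple of its coefficient.\<close>
  have "k1 = 0" using arg_cong[OF sum, of "\<lambda>z. dot \<phi> (contract (axis 1 1) z)"] \<phi> ac(3) ac'(4) by (simp add: axis_nth)
  moreover have "k2 = 0" using arg_cong[OF sum, of "\<lambda>z. dot \<phi> (contract (axis 2 1) z)"] \<phi> ac(3) ac'(4) by (simp add: axis_nth)
  moreover have "k3 = 0" using arg_cong[OF sum, of "\<lambda>z. dot \<phi> (contract (axis 3 1) z)"] \<phi> ac(3) ac'(4) by (simp add: axis_nth)
  ultimately have sum': "l *s tensor a c + l' *s tensor a' c' = 0" using sum by simp
  have "l = 0" using arg_cong[OF sum', of "contract \<psi>"] \<psi> ac(2) ac'(3) by simp
  obtain \<theta> where "dot \<theta> a' \<noteq> 0" using nonzero_functional[OF ac'(1)] .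
  then have "l' = 0" using arg_cong[OF sum', of "contract \<theta>"] \<open>l = 0\<close> ac'(2) by simp
  with \<open>l = 0\<close> \<open>k1 = 0\<close> \<open>k2 = 0\<close> \<open>k3 = 0\<close> k show False by simp
qed

section \<open>Codimension four: products in the kernel of a map into
  \<open>complex^4\<close>\<close>

lemma parallel_if_combination_0:
  fixes b1 b2 :: "complex^'n"
  assumes "x *s b1 + y *s b2 = 0" "x \<noteq> 0" "b1 \<noteq> 0"
  obtains k where "k \<noteq> 0" "b2 = k *s b1"
proof -
  have y: "y \<noteq> 0"
  proof
    assume "y = 0"
    then have "x *s b1 = 0" using assms(1) by simp
    then show False using assms(2,3) by simp
  qed
  have "y *s b2 = (- x) *s b1" using assms by (simp add: add_eq_0_iff)
  then have "inverse y *s (y *s b2) = inverse y *s ((- x) *s b1)" by simp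
  then have "b2 = (inverse y * (- x)) *s b1" using y by (simp only: vec.scale_scale left_inverse vec.scale_one not_False_eq_True)
  moreover have "inverse y * (- x) \<noteq> 0" using assms y by simp
  ultimately show ?thesis using that by blast
qed

text \<open>Contraction with \<open>\<xi>\<close> drops the third product and leaves a relation
  between \<open>b1\<close> and \<open>b2\<close>. Its coefficient at \<open>b1\<close> is nonzero,
  since otherwise \<open>c1\<close>, \<open>c2\<close> and \<open>c3\<close> vanish in turn.\<close>

lemma dependent_products:
  assumes dep: "c1 *s tensor a1 b1 + c2 *s tensor a2 b2 + c3 *s tensor a3 b3 = 0"
    and c: "c1 \<noteq> 0 \<or> c2 \<noteq> 0 \<or> c3 \<noteq> 0" and nz: "a3 \<noteq> 0" "b1 \<noteq> 0" "b2 \<noteq> 0" "b3 \<noteq> 0"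
    and \<psi>: "dot \<psi> a1 \<noteq> 0" "dot \<psi> a2 = 0"
    and \<xi>: "dot \<xi> a1 \<noteq> 0" "dot \<xi> a2 \<noteq> 0" "dot \<xi> a3 = 0"
  obtains k where "k \<noteq> 0" "b2 = k *s b1"
proof -
  have e\<xi>: "(c1 * dot \<xi> a1) *s b1 + (c2 * dot \<xi> a2) *s b2 = 0"
    using arg_cong[OF dep, of "contract \<xi>"] \<xi> by (simp add: vec.scale_scale)
  have c1: "c1 \<noteq> 0"
  proof
    assume "c1 = 0"
    then have "c2 = 0" using e\<xi> \<xi> nz by simp
    obtain \<theta> where "dot \<theta> a3 \<noteq> 0" using nonzero_functional[OF nz(1)] .
    then have "c3 = 0"
      using arg_cong[OF dep, of "contract \<theta>"] \<open>c1 = 0\<close> \<open>c2 = 0\<close> nz by simp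
    with c \<open>c1 = 0\<close> \<open>c2 = 0\<close> show False by simp
  qed
  from c1 \<xi>(1) have "c1 * dot \<xi> a1 \<noteq> 0" by simp
  then show ?thesis by (rule parallel_if_combination_0[OF e\<xi> _ nz(2)]) (rule that)
qed

text \<open>If all kernel products lay in a \<open>Z\<close> of dimension below 3, they would be
  exactly the products of the plane of \<open>a1\<close>, \<open>a2\<close> with one vector
  \<open>b\<close>. A pencil argument on a space of second factors avoiding \<open>b\<close> then
  produces a kernel product of another kind.\<close>

lemma kernel_products_span_3:
  fixes F :: "complex^(3 \<times> 4) \<Rightarrow> complex^4"
  assumes F: "clinear F" and Z: "vec.subspace Z" "vec.dim Z < 3"
  obtains a b where "F (tensor a b) = 0" "tensor a b \<notin> Z"
proof (rule ccontr)
  assume neg: "\<not> thesis"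
  note obt = that
  have mem: "tensor a b \<in> Z" if "F (tensor a b) = 0" for a b
    using obt[OF that] neg by blast
  note F_simps = clinear_simps[OF F]
  have UNIV4: "CARD(4) \<le> vec.dim (UNIV :: (complex^4) set)" by (simp add: vec.dim_UNIV card_cart_basis)
  note product = product_in_kernel[OF F vec.subspace_UNIV UNIV4]
  obtain a1 b where a1: "a1 \<noteq> 0" "b \<noteq> 0" "F (tensor a1 b) = 0"
    using product[of 0] by metis
  obtain \<psi> where \<psi>: "dot \<psi> a1 \<noteq> 0" using nonzero_functional[OF a1(1)] .
  obtain a2 b2 where a2: "a2 \<noteq> 0" "b2 \<noteq> 0" "dot \<psi> a2 = 0" "F (tensor a2 b2) = 0"
    using product[of \<psi>] by metis
  \<comment> \<open>With \<open>a3\<close> in the kernel of \<open>\<xi>\<close>, contraction by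
    \<open>\<xi>\<close> removes the third product from the forced relation, so \<open>b2\<close> is
    a multiple of \<open>b\<close>.\<close>
  obtain \<xi> where \<xi>: "dot \<xi> a1 \<noteq> 0" "dot \<xi> a2 \<noteq> 0" using nonzero_functional_2[OF a1(1) a2(1)] .
  obtain a3 b3 where a3: "a3 \<noteq> 0" "b3 \<noteq> 0" "dot \<xi> a3 = 0" "F (tensor a3 b3) = 0"
    using product[of \<xi>] by metis
  obtain c1 c2 c3 where c: "c1 \<noteq> 0 \<or> c2 \<noteq> 0 \<or> c3 \<noteq> 0"
    "c1 *s tensor a1 b + c2 *s tensor a2 b2 + c3 *s tensor a3 b3 = 0"
    using dependent_3[OF mem[OF a1(3)] mem[OF a2(4)] mem[OF a3(4)] Z(2)] .
  obtain k where k: "k \<noteq> 0" "b2 = k *s b"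
    using dependent_products[OF c(2,1) a3(1) a1(2) a2(2) a3(2) \<psi> a2(3) \<xi> a3(3)] .
  have a2b: "F (tensor a2 b) = 0" using a2(4) k by (simp add: tensor_simps F_simps)
  have indep: "s = 0 \<and> t = 0" if "s *s a1 + t *s a2 = 0" for s t
  proof -
    have "s * dot \<psi> a1 + t * dot \<psi> a2 = 0" using arg_cong[OF that, of "dot \<psi>"] by simp
    then have "s = 0" using \<psi> a2(3) by simp
    then show ?thesis using that a2(1) by simp
  qed

  have "vec.dim (vec.span {a1, a2}) < vec.dim (UNIV :: (complex^3) set)"
    using vec.dim_le_card[of "vec.span {a1, a2}" "{a1, a2}"] card_insert_le_m1[of 2 "{a2}" a1]
    by (simp add: vec.dim_UNIV card_cart_basis)
  then obtain a0 where "a0 \<notin> vec.span {a1, a2}" by (metis UNIV_eq_I less_irrefl)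
  then obtain \<omega> where \<omega>: "dot \<omega> a1 = 0" "dot \<omega> a2 = 0" "dot \<omega> a0 \<noteq> 0"
    using separating_functional[OF vec.subspace_span] by (metis insertI1 insertI2 vec.span_base)
  \<comment> \<open>The products of \<open>a1\<close> and \<open>a2\<close> with \<open>b\<close>
    are independent, so any kernel product depends on them. Contraction with \<open>\<omega>\<close>
    puts its first factor into their plane; contraction with a functional nonzero at
    \<open>a\<close> makes its second factor a multiple of \<open>b\<close>.\<close>
  have unique: "dot \<omega> a = 0 \<and> (\<exists>k. c = k *s b)" if ac: "a \<noteq> 0" "c \<noteq> 0" "F (tensor a c) = 0" for a c
  proof -
    obtain k1 k2 k3 where k: "k1 \<noteq> 0 \<or> k2 \<noteq> 0 \<or> k3 \<noteq> 0"
      "k1 *s tensor a1 b + k2 *s tensor a2 b + k3 *s tensor a c = 0"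
      using dependent_3[OF mem[OF a1(3)] mem[OF a2b] mem[OF ac(3)] Z(2)] .
    have "k3 \<noteq> 0"
    proof
      assume "k3 = 0"
      then have sum: "tensor (k1 *s a1 + k2 *s a2) b = 0" using k(2) by (simp add: tensor_simps)
      have "k1 *s a1 + k2 *s a2 = 0"
      proof (rule ccontr)
        assume "k1 *s a1 + k2 *s a2 \<noteq> 0"
        then obtain \<theta> where "dot \<theta> (k1 *s a1 + k2 *s a2) \<noteq> 0" using nonzero_functional by metis
        then show False using arg_cong[OF sum, of "contract \<theta>"] a1(2) by simp
      qed
      with indep k(1) \<open>k3 = 0\<close> show False by blast
    qed
    have "dot \<omega> a = 0" using arg_cong[OF k(2), of "contract \<omega>"] \<omega> ac(2) \<open>k3 \<noteq> 0\<close> by simp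
    moreover obtain \<theta> where \<theta>: "dot \<theta> a \<noteq> 0" using nonzero_functional[OF ac(1)] .
    have "(k3 * dot \<theta> a) *s c + (k1 * dot \<theta> a1 + k2 * dot \<theta> a2) *s b = 0"
      using arg_cong[OF k(2), of "contract \<theta>"] by (simp add: vec.scale_left_distrib vec.scale_scale add_ac)
    then obtain l where "l \<noteq> 0" "b = l *s c"
      using parallel_if_combination_0[OF _ _ ac(2)] \<theta> \<open>k3 \<noteq> 0\<close> by (metis mult_eq_0_iff)
    then have "c = inverse l *s b" by (simp add: vec.scale_scale)
    ultimately show ?thesis by blast
  qed
  have "inj (\<lambda>x. F (tensor a0 x))"
  proof (rule injI)
    fix x y assume "F (tensor a0 x) = F (tensor a0 y)"
    then have "F (tensor a0 (x - y)) = 0" by (simp add: tensor_simps F_simps)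
    moreover have "a0 \<noteq> 0" using \<omega>(3) by auto
    ultimately show "x = y" using unique[of a0 "x - y"] \<omega>(3) by auto
  qed
  then obtain G where G: "clinear G" "\<And>x. G (F (tensor a0 x)) = x" "\<And>x. F (tensor a0 (G x)) = x"
    using vec.linear_injective_isomorphism[OF clinear_tensor[OF F]] by metis
  obtain \<phi> where \<phi>: "dot \<phi> b \<noteq> 0" using nonzero_functional[OF a1(2)] .
  define A where "A \<tau> = a1 + \<tau> *s a2" for \<tau>
  have Ab: "F (tensor (A \<tau>) b) = 0" for \<tau> using a1(3) a2b by (simp add: A_def tensor_simps F_simps)
  have A0: "A \<tau> \<noteq> 0" for \<tau> using indep[of 1 \<tau>] by (auto simp: A_def)
  define d where "d = F (tensor a0 b)"
  have d0: "d \<noteq> 0" using G(2)[of b] a1(2) clinear_simps(4)[OF G(1)] unfolding d_def by metis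

  text \<open>The pencil relative to \<open>a0\<close> has no eigenvalue but \<open>0\<close>, whose eigenvectors are the multiples
    of \<open>b\<close>; an eigenvector inside the range of the pencil thus shows that \<open>b\<close> lies in the range.\<close>
  have "\<exists>v. dot \<phi> v = 0 \<and> F (tensor (A \<tau>) v) = d" for \<tau>
  proof -
    define T where "T x = G (F (tensor (A \<tau>) x))" for x
    have T: "clinear T" unfolding T_def
      by (rule clinearI) (simp_all add: tensor_simps F_simps clinear_simps[OF G(1)])
    have sub: "vec.subspace (range T)" by (rule vec.linear_subspace_image[OF T vec.subspace_UNIV])
    have "vec.dim (vec.span {b}) < vec.dim (UNIV :: (complex^4) set)"
      using vec.dim_le_card[of "vec.span {b}" "{b}"] by (simp add: vec.dim_UNIV card_cart_basis)
    \<comment> \<open>A vector off the line of \<open>b\<close> is not killed by \<open>T\<close>,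
      so the range of \<open>T\<close> is nonzero and contains an eigenvector.\<close>
    then obtain c where c: "c \<notin> vec.span {b}" by (metis UNIV_eq_I less_irrefl)
    then have "c \<noteq> 0" using vec.span_zero by metis
    then have "F (tensor (A \<tau>) c) \<noteq> 0" using unique[OF A0, of c \<tau>] c by (auto simp: vec.span_singleton)
    moreover have T_inv: "F (tensor a0 (T x)) = F (tensor (A \<tau>) x)" for x unfolding T_def by (rule G(3))
    moreover have "F (tensor a0 0) = 0" by (simp add: tensor_simps F_simps)
    ultimately have Tc: "T c \<noteq> 0" by metis
    have inv: "T ` range T \<subseteq> range T" by blast
    obtain x \<mu> where x: "x \<in> range T" "x \<noteq> 0" "T x = \<mu> *s x"
      using eigenvector_in_subspace[OF T sub inv rangeI Tc] .
    have "F (tensor (A \<tau>) x) = F (tensor a0 (\<mu> *s x))" using T_inv[of x] x(3) by simp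
    then have zero: "F (tensor (A \<tau> - \<mu> *s a0) x) = 0" by (simp add: tensor_simps F_simps)
    have nzA: "A \<tau> - \<mu> *s a0 \<noteq> 0"
    proof
      assume "A \<tau> - \<mu> *s a0 = 0"
      from arg_cong[OF this, of "dot \<omega>"] have "\<mu> = 0" using \<omega> by (simp add: A_def)
      with \<open>A \<tau> - \<mu> *s a0 = 0\<close> A0 show False by simp
    qed
    obtain k where k: "x = k *s b" using unique[OF nzA x(2) zero] by (elim conjE exE)
    then have "k \<noteq> 0" using x(2) by auto
    then have "b \<in> range T" using subspace_scale_cancel[OF sub, of k b] x(1) k by simp
    then obtain v where "b = T v" by blast
    then have "F (tensor (A \<tau>) v) = d" unfolding d_def using T_inv[of v] by simp
    \<comment> \<open>Subtracting a multiple of \<open>b\<close> does not change the image, as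
      \<open>b\<close> is killed. The normalization keeps the span of all \<open>v \<tau>\<close>
      free of nonzero multiples of \<open>b\<close>, which gives the final contradiction.\<close>
    then show ?thesis using \<phi> Ab
      by (intro exI[of _ "v - (dot \<phi> v / dot \<phi> b) *s b"]) (simp add: tensor_simps F_simps)
  qed
  then obtain v where v: "\<And>\<tau>. dot \<phi> (v \<tau>) = 0" "\<And>\<tau>. F (tensor (A \<tau>) (v \<tau>)) = d" by metis

  text \<open>The span of all \<open>v \<tau>\<close> is mapped by both generators of the pencil into a space of no larger
    dimension, since any further \<open>v \<tau>\<close> yields a linear relation among the images.\<close>
  let ?L1 = "\<lambda>x. F (tensor a1 x)" and ?L2 = "\<lambda>x. F (tensor a2 x)"
  note L1 = clinear_tensor[OF F, of a1] and L2 = clinear_tensor[OF F, of a2]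
  have L12: "?L1 (v \<tau>) = d - \<tau> *s ?L2 (v \<tau>)" for \<tau>
    using v(2)[of \<tau>] by (simp add: A_def tensor_simps F_simps eq_diff_eq)
  obtain X where X: "X \<subseteq> range v" "vec.independent X" "range v \<subseteq> vec.span X" "card X = vec.dim (range v)"
    by (rule vec.basis_exists)
  have finX: "finite X" using X(2) by (rule vec.finiteI_independent)
  define t where "t = inv_into UNIV v"
  have t: "v (t x) = x" if "x \<in> X" for x unfolding t_def using X(1) that by (intro f_inv_into_f) (rule subsetD)
  \<comment> \<open>A parameter different from those of all basis vectors exists because there are
    infinitely many complex numbers; the differences \<open>t0 - t x\<close> are then
    nonzero.\<close>
  obtain t0 where t0: "t0 \<notin> t ` X"
    using ex_new_if_finite[OF infinite_UNIV_char_0 finite_imageI[OF finX]] by (rule exE)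
  have "v t0 \<in> vec.span X" using X(3) by blast
  then obtain c where c: "v t0 = (\<Sum>x\<in>X. c x *s x)" unfolding vec.span_finite[OF finX] by (rule rangeE)
  have "v t0 \<noteq> 0"
  proof
    assume "v t0 = 0"
    with v(2)[of t0] d0 show False by (simp add: tensor_simps F_simps)
  qed
  then have "\<exists>x0\<in>X. c x0 *s x0 \<noteq> 0" unfolding c using sum.neutral[of X "\<lambda>x. c x *s x"] by metis
  then obtain x0 where x0: "x0 \<in> X" "c x0 \<noteq> 0" by (auto simp: vec.scale_eq_0_iff)
  \<comment> \<open>Adding \<open>d\<close> and omitting the image of \<open>x0\<close> balance in
    the count, so the dimension of \<open>Y\<close> is at most the number of elements of
    \<open>X\<close>.\<close>
  define Y where "Y = vec.span (insert d (?L2 ` (X - {x0})))"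
  have Y: "vec.subspace Y" unfolding Y_def by (rule vec.subspace_span)
  have dY: "d \<in> Y" unfolding Y_def by (intro vec.span_base) simp
  have L2Y': "?L2 x \<in> Y" if "x \<in> X" "x \<noteq> x0" for x unfolding Y_def using that by (intro vec.span_base) simp
  \<comment> \<open>Expanding \<open>v t0\<close> in \<open>X\<close> and replacing
    \<open>?L1 x\<close> by \<open>d - t x *s ?L2 x\<close> leaves a relation between
    \<open>d\<close> and the vectors \<open>?L2 x\<close>. The coefficient of \<open>?L2 x0\<close>
    is \<open>c x0 * (t0 - t x0)\<close>, nonzero by the choice of \<open>x0\<close> and
    \<open>t0\<close>, so the omitted image lies in \<open>Y\<close> after all.\<close>
  have "d = ?L1 (v t0) + t0 *s ?L2 (v t0)" using L12[of t0] by simp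
  also have "\<dots> = (\<Sum>x\<in>X. c x *s ?L1 x + t0 *s (c x *s ?L2 x))"
    unfolding c by (simp add: clinear_simps[OF L1] clinear_simps[OF L2] sum.distrib vec.scale_sum_right)
  also have "\<dots> = (\<Sum>x\<in>X. c x *s d + (c x * (t0 - t x)) *s ?L2 x)"
  proof (rule sum.cong[OF refl])
    fix x assume "x \<in> X"
    then have "?L1 x = d - t x *s ?L2 x" using L12[of "t x"] t by simp
    then show "c x *s ?L1 x + t0 *s (c x *s ?L2 x) = c x *s d + (c x * (t0 - t x)) *s ?L2 x"
      by (simp only:) (simp add: vec_eq_iff algebra_simps)
  qed
  also have "\<dots> = (c x0 * (t0 - t x0)) *s ?L2 x0 + (c x0 *s d + (\<Sum>x\<in>X - {x0}. c x *s d + (c x * (t0 - t x)) *s ?L2 x))"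
    using finX x0(1) by (simp add: sum.remove[of X x0])
  finally have "(c x0 * (t0 - t x0)) *s ?L2 x0 = d - (c x0 *s d + (\<Sum>x\<in>X - {x0}. c x *s d + (c x * (t0 - t x)) *s ?L2 x))"
    by (simp add: eq_diff_eq)
  also have "\<dots> \<in> Y"
    using L2Y' dY by (intro vec.subspace_diff vec.subspace_add vec.subspace_scale vec.subspace_sum Y) auto
  finally have "?L2 x0 \<in> Y"
    by (rule subspace_scale_cancel[OF Y, rotated]) (use x0 t0 in auto)
  with L2Y' have L2Y: "?L2 x \<in> Y" if "x \<in> X" for x using that by blast
  have L1Y: "?L1 x \<in> Y" if "x \<in> X" for x
    using L12[of "t x"] t[OF that] L2Y[OF that] dY by (simp add: vec.subspace_diff vec.subspace_scale Y)
  have "?L1 ` vec.span X = vec.span (?L1 ` X)" "?L2 ` vec.span X = vec.span (?L2 ` X)"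
    by (simp_all only: vec.linear_span_image[OF L1] vec.linear_span_image[OF L2])
  then have img: "?L1 ` vec.span X \<subseteq> Y" "?L2 ` vec.span X \<subseteq> Y"
    using L1Y L2Y Y by (simp_all add: vec.span_minimal image_subset_iff)
  have "vec.dim Y \<le> card (insert d (?L2 ` (X - {x0})))"
    unfolding Y_def using finX by (intro vec.dim_le_card) auto
  also have "\<dots> \<le> Suc (card (?L2 ` (X - {x0})))"
    using finX by (simp add: card_insert_if)
  also have "\<dots> \<le> Suc (card (X - {x0}))"
    using finX card_image_le[of "X - {x0}" ?L2] by simp
  also have "\<dots> = vec.dim (vec.span X)"
    using vec.dim_span_eq_card_independent[OF X(2)] card_Suc_Diff1[OF finX x0(1)] by simp
  finally have dim: "vec.dim Y \<le> vec.dim (vec.span X)" .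
  have x0': "x0 \<in> vec.span X" "x0 \<noteq> 0" using x0(1) X(2) vec.dependent_zero by (auto intro: vec.span_base)
  obtain s r x where x: "s \<noteq> 0 \<or> r \<noteq> 0" "x \<in> vec.span X" "x \<noteq> 0" "s *s ?L1 x + r *s ?L2 x = 0"
    using pencil_singular[OF L1 L2 vec.subspace_span x0' Y img dim] .
  have "F (tensor (s *s a1 + r *s a2) x) = 0" using x(4) by (simp add: tensor_simps F_simps)
  moreover have "s *s a1 + r *s a2 \<noteq> 0" using indep x(1) by blast
  ultimately obtain k where k: "x = k *s b" using unique[OF _ x(3)] by metis
  have "X \<subseteq> {x. dot \<phi> x = 0}" using X(1) v(1) by auto
  then have "vec.span X \<subseteq> {x. dot \<phi> x = 0}" using subspace_dot_kernel by (rule vec.span_minimal)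
  then have "dot \<phi> x = 0" using x(2) by blast
  then show False using k \<phi> x(3) by simp
qed

section \<open>Spectral decomposition of Hermitian matrices\<close>

definition cip :: "complex^'n \<Rightarrow> complex^'n \<Rightarrow> complex" where
  "cip x y = (\<Sum>i\<in>UNIV. cnj (x $ i) * y $ i)"

lemma cip_simps [simp]:
  "cip x (y + z) = cip x y + cip x z" "cip x (y - z) = cip x y - cip x z"
  "cip x (c *s y) = c * cip x y" "cip x 0 = 0" "cip (c *s x) y = cnj c * cip x y"
  by (simp_all add: cip_def sum.distrib sum_subtractf sum_distrib_left algebra_simps)

lemma cip_sum: "cip x (\<Sum>k\<in>I. f k) = (\<Sum>k\<in>I. cip x (f k))"
  by (simp add: cip_def sum_distrib_left) (rule sum.swap)

lemma cnj_cip: "cnj (cip x y) = cip y x"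
  by (simp add: cip_def mult.commute)

lemma cip_self: "cip x x = of_real (\<Sum>i\<in>UNIV. (cmod (x $ i))\<^sup>2)"
  by (simp only: cip_def mult.commute[of "cnj _"] complex_norm_square[symmetric] of_real_sum of_real_power)

lemma cip_eq_0 [simp]: "cip x x = 0 \<longleftrightarrow> x = 0"
  unfolding cip_self of_real_eq_0_iff by (simp add: sum_nonneg_eq_0_iff vec_eq_iff)

lemma normalize_cip:
  assumes "x \<noteq> 0"
  obtains c where "c \<noteq> 0" "cip (c *s x) (c *s x) = 1"
proof -
  define s where "s = (\<Sum>i\<in>UNIV. (cmod (x $ i))\<^sup>2)"
  have s: "cip x x = of_real s" unfolding s_def by (rule cip_self)
  have "s \<noteq> 0" using assms cip_eq_0[of x] unfolding s of_real_eq_0_iff by simp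
  moreover have "0 \<le> s" unfolding s_def by (intro sum_nonneg) simp
  ultimately have pos: "s > 0" by simp
  let ?c = "complex_of_real (1 / sqrt s)"
  have "cip (?c *s x) (?c *s x) = of_real (1 / sqrt s * (1 / sqrt s) * s)"
    by (simp only: cip_simps s complex_cnj_complex_of_real of_real_mult mult.assoc)
  also have "1 / sqrt s * (1 / sqrt s) * s = 1" using pos by simp
  finally show ?thesis using that[of ?c] pos by simp
qed

text \<open>Self-adjointness makes the orthogonal complement of the eigenvectors found so far
  invariant under \<open>T\<close>. It is nonzero while there are fewer than CARD('n) of them, so it
  contains a further eigenvector, which is then normalized.\<close>

lemma orthonormal_eigenvectors:
  fixes T :: "complex^'n \<Rightarrow> complex^'n"
  assumes T: "clinear T" and self_adjoint: "\<And>x y. cip (T x) y = cip x (T y)"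
    and "k \<le> CARD('n)"
  shows "\<exists>p \<mu>. \<forall>i<k. T (p i) = \<mu> i *s p i \<and> (\<forall>j<k. cip (p i) (p j) = (if i = j then 1 else 0))"
  using \<open>k \<le> CARD('n)\<close>
proof (induction k)
  case 0
  show ?case by simp
next
  case (Suc k)
  then obtain p \<mu> where p: "\<And>i. i < k \<Longrightarrow> T (p i) = \<mu> i *s p i"
    "\<And>i j. i < k \<Longrightarrow> j < k \<Longrightarrow> cip (p i) (p j) = (if i = j then 1 else 0)" by auto
  let ?S = "{x. \<forall>i<k. cip (p i) x = 0}"
  have S: "vec.subspace ?S" by (auto intro!: vec.subspaceI)
  have inv: "T ` ?S \<subseteq> ?S"
  proof clarify
    fix x i assume x: "\<forall>i<k. cip (p i) x = 0" "i < k"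
    have "cip (p i) (T x) = cip (\<mu> i *s p i) x" using x p(1) self_adjoint by metis
    then show "cip (p i) (T x) = 0" using x by simp
  qed
  have "vec.dim (vec.span (p ` {..<k})) \<le> k"
    using vec.dim_le_card[of "vec.span (p ` {..<k})" "p ` {..<k}"] card_image_le[of "{..<k}" p] by simp
  also have "k < vec.dim (UNIV :: (complex^'n) set)"
    using Suc.prems by (simp add: vec.dim_UNIV card_cart_basis)
  finally obtain x where x: "x \<notin> vec.span (p ` {..<k})" by (metis UNIV_eq_I less_irrefl)
  define y where "y = x - (\<Sum>i<k. cip (p i) x *s p i)"
  have yS: "y \<in> ?S"
  proof clarify
    fix j assume j: "j < k"
    have "cip (p j) y = cip (p j) x - (\<Sum>i<k. if i = j then cip (p i) x else 0)"
      unfolding y_def using j by (simp add: cip_sum p(2) if_distrib cong: if_cong)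
    then show "cip (p j) y = 0" using j by simp
  qed
  have "y \<noteq> 0"
  proof
    assume "y = 0"
    then have "x = (\<Sum>i<k. cip (p i) x *s p i)" by (simp add: y_def)
    also have "\<dots> \<in> vec.span (p ` {..<k})" by (intro vec.span_sum vec.span_scale vec.span_base) simp
    finally show False using x by simp
  qed
  then obtain z \<nu> where z: "z \<in> ?S" "z \<noteq> 0" "T z = \<nu> *s z"
    using eigenvector_in_subspace[OF T S inv yS] by blast
  obtain c where c: "c \<noteq> 0" "cip (c *s z) (c *s z) = 1" using normalize_cip[OF z(2)] .
  have T_cz: "T (c *s z) = \<nu> *s (c *s z)"
    unfolding clinear_simps(3)[OF T] z(3) by (simp add: vec_eq_iff)
  have orth: "cip (p i) (c *s z) = 0" "cip (c *s z) (p i) = 0" if "i < k" for i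
  proof -
    show *: "cip (p i) (c *s z) = 0" using z(1) that by simp
    show "cip (c *s z) (p i) = 0" by (subst cnj_cip[symmetric]) (simp only: * complex_cnj_zero)
  qed
  have "\<forall>i<Suc k. T ((p(k := c *s z)) i) = (\<mu>(k := \<nu>)) i *s (p(k := c *s z)) i \<and>
      (\<forall>j<Suc k. cip ((p(k := c *s z)) i) ((p(k := c *s z)) j) = (if i = j then 1 else 0))"
    using p T_cz orth c(2) by (auto simp: less_Suc_eq simp del: cip_simps)
  then show ?case by blast
qed

lemma orthonormal_eigenbasis:
  fixes T :: "complex^'n \<Rightarrow> complex^'n"
  assumes T: "clinear T" and self_adjoint: "\<And>x y. cip (T x) y = cip x (T y)"
  shows "\<exists>p :: nat \<Rightarrow> complex^'n. \<exists>\<mu> :: nat \<Rightarrow> real.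
    (\<forall>k<CARD('n). T (p k) = complex_of_real (\<mu> k) *s p k) \<and>
    (\<forall>k<CARD('n). \<forall>l<CARD('n). cip (p k) (p l) = (if k = l then 1 else 0)) \<and>
    (\<forall>x. x = (\<Sum>k<CARD('n). cip (p k) x *s p k)) \<and>
    (\<forall>x. cip x (T x) = (\<Sum>k<CARD('n). of_real (\<mu> k * (cmod (cip (p k) x))\<^sup>2)))"
proof -
  let ?N = "CARD('n)"
  obtain p \<nu> where p: "\<And>i. i < ?N \<Longrightarrow> T (p i) = \<nu> i *s p i"
    "\<And>i j. i < ?N \<Longrightarrow> j < ?N \<Longrightarrow> cip (p i) (p j) = (if i = j then 1 else 0)"
    using orthonormal_eigenvectors[OF T self_adjoint order_refl] by blast
  have real: "\<nu> k = of_real (Re (\<nu> k))" if k: "k < ?N" for k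
  proof -
    have "cip (T (p k)) (p k) = cip (p k) (T (p k))" by (rule self_adjoint)
    then have "cnj (\<nu> k) = \<nu> k" using p k by simp
    then show ?thesis by (simp add: complex_eq_iff)
  qed
  have expand: "x = (\<Sum>k<?N. cip (p k) x *s p k)" for x
  proof -
    define y where "y = x - (\<Sum>k<?N. cip (p k) x *s p k)"
    have orth: "cip (p j) y = 0" if j: "j < ?N" for j
    proof -
      have "cip (p j) y = cip (p j) x - (\<Sum>i<?N. if i = j then cip (p i) x else 0)"
        unfolding y_def using j by (simp add: cip_sum p(2) if_distrib cong: if_cong)
      then show ?thesis using j by simp
    qed
    \<comment> \<open>The residue \<open>y\<close> is appended to the orthonormal vectors, which
      makes one vector too many. Pairing the resulting relation with each \<open>p j\<close> kills
      all coefficients but that of \<open>y\<close>, hence \<open>y = 0\<close>.\<close>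
    let ?v = "\<lambda>i. if i < ?N then p i else y"
    have "vec.dim (UNIV :: (complex^'n) set) < card {..?N}" by (simp add: vec.dim_UNIV card_cart_basis)
    from dependent_family[OF _ _ this, of ?v]
    obtain c where c: "\<exists>i\<in>{..?N}. c i \<noteq> 0" "(\<Sum>i\<le>?N. c i *s ?v i) = 0" by auto
    have sum: "(\<Sum>i<?N. c i *s p i) + c ?N *s y = 0"
      using c(2) by (simp add: lessThan_Suc_atMost[symmetric])
    have c0: "c j = 0" if j: "j < ?N" for j
    proof -
      have "cip (p j) (\<Sum>i<?N. c i *s p i) = (\<Sum>i<?N. if i = j then c i else 0)"
        unfolding cip_sum using j by (intro sum.cong) (auto simp: p(2))
      then show ?thesis using arg_cong[OF sum, of "cip (p j)"] orth[OF j] j by simp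
    qed
    then have "c ?N \<noteq> 0" using c(1) by (metis atMost_iff le_neq_implies_less)
    moreover have "c ?N *s y = 0" using sum c0 by simp
    ultimately have "y = 0" by simp
    then show ?thesis by (simp add: y_def)
  qed
  have quad: "cip x (T x) = (\<Sum>k<?N. of_real (Re (\<nu> k) * (cmod (cip (p k) x))\<^sup>2))" for x
  proof -
    have "T x = (\<Sum>k<?N. cip (p k) x *s (\<nu> k *s p k))"
      by (subst expand[of x]) (simp add: clinear_simps[OF T] p(1))
    then have "cip x (T x) = (\<Sum>k<?N. cip (p k) x * (\<nu> k * cip x (p k)))"
      by (simp add: cip_sum mult.assoc)
    also have "\<dots> = (\<Sum>k<?N. of_real (Re (\<nu> k) * (cmod (cip (p k) x))\<^sup>2))"
    proof (rule sum.cong[OF refl])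
      fix k assume "k \<in> {..<?N}"
      then have "\<nu> k = of_real (Re (\<nu> k))" using real by simp
      then show "cip (p k) x * (\<nu> k * cip x (p k)) = of_real (Re (\<nu> k) * (cmod (cip (p k) x))\<^sup>2)"
        using cnj_cip[of "p k" x] complex_norm_square[of "cip (p k) x"]
        by (metis (no_types, lifting) mult.assoc mult.commute of_real_mult)
    qed
    finally show ?thesis .
  qed
  have "T (p k) = of_real (Re (\<nu> k)) *s p k" if "k < ?N" for k
    unfolding real[OF that, symmetric] by (rule p(1)[OF that])
  then have "\<forall>k<?N. T (p k) = of_real (Re (\<nu> k)) *s p k" by blast
  moreover have "\<forall>k<?N. \<forall>l<?N. cip (p k) (p l) = (if k = l then 1 else 0)" by (simp add: p(2))
  moreover have "\<forall>x. x = (\<Sum>k<?N. cip (p k) x *s p k)" by (intro allI expand)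
  moreover have "\<forall>x. cip x (T x) = (\<Sum>k<?N. of_real (Re (\<nu> k) * (cmod (cip (p k) x))\<^sup>2))"
    by (intro allI quad)
  ultimately show ?thesis by (intro exI conjI)
qed

section \<open>Hermitian matrices with numerical indices, their eigenvalues and inertia\<close>

lemma hermitian_index:
  assumes "hermitian A" "A \<in> carrier_mat n n" "i < n" "j < n"
  shows "A $$ (j, i) = cnj (A $$ (i, j))"
proof -
  have "mat_adjoint A $$ (j, i) = cnj (A $$ (i, j))"
    using assms(2-) by (simp add: mat_adjoint_def mat_of_rows_index conjugate_complex_def)
  then show ?thesis using assms(1) by (simp add: hermitian_def)
qed

lemma hermitianI:
  assumes "A \<in> carrier_mat n n" "\<And>i j. i < n \<Longrightarrow> j < n \<Longrightarrow> A $$ (j, i) = cnj (A $$ (i, j))"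
  shows "hermitian A"
  unfolding hermitian_def
proof (rule eq_matI)
  fix i j assume "i < dim_row A" "j < dim_col A"
  then have ij: "i < n" "j < n" using assms(1) by simp_all
  then have "mat_adjoint A $$ (i, j) = cnj (A $$ (j, i))"
    using assms(1) by (simp add: mat_adjoint_def mat_of_rows_index conjugate_complex_def)
  then show "mat_adjoint A $$ (i, j) = A $$ (i, j)" using assms(2)[OF ij(2,1)] by simp
qed (use assms(1) in \<open>simp_all add: mat_adjoint_def\<close>)

lemma proots_linear_factors:
  fixes d :: "nat \<Rightarrow> complex"
  shows "proots (\<Prod>a\<leftarrow>map d [0..<n]. [:- a, 1:]) = image_mset d (mset_set {..<n})"
proof (induction n)
  case 0
  show ?case by simp
next
  case (Suc n)
  have "(\<Prod>a\<leftarrow>map d [0..<n]. [:- a, 1:]) \<noteq> 0" by (auto simp: prod_list_zero_iff)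
  then have "proots ((\<Prod>a\<leftarrow>map d [0..<n]. [:- a, 1:]) * [:- d n, 1:])
      = proots (\<Prod>a\<leftarrow>map d [0..<n]. [:- a, 1:]) + {#d n#}"
    by (subst proots_mult) simp_all
  with Suc.IH show ?case by (simp add: lessThan_Suc)
qed

lemma eigenvalues_mset_diagonal:
  assumes D: "D = Matrix.mat n n (\<lambda>(k, l). if k = l then d k else 0)"
  shows "eigenvalues_mset D = image_mset d (mset_set {..<n})"
proof -
  have "upper_triangular D" "D \<in> carrier_mat n n" by (auto simp: D)
  then have "char_poly D = (\<Prod>a\<leftarrow>diag_mat D. [:- a, 1:])"
    by (intro char_poly_upper_triangular)
  moreover have "diag_mat D = map d [0..<n]" by (simp add: diag_mat_def D)
  ultimately show ?thesis unfolding eigenvalues_mset_def by (simp only: proots_linear_factors)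
qed

text \<open>Carries the spectral theorem from \<open>complex^'n\<close> to matrices indexed by
  numbers, along an enumeration \<open>f\<close> of the index type. The eigenbasis is the matrix
  \<open>P\<close> with inverse \<open>Q\<close>, its conjugate transpose;
  \<open>A * P = P * D\<close> makes \<open>A\<close> similar to the diagonal matrix
  \<open>D\<close>, so both have the same characteristic polynomial and the \<open>\<mu> k\<close>
  are the eigenvalues with multiplicity.\<close>

lemma hermitian_eigenbasis:
  fixes f :: "'n::finite \<Rightarrow> nat"
  assumes f: "bij_betw f UNIV {..<CARD('n)}"
    and A: "A \<in> carrier_mat CARD('n) CARD('n)" "hermitian A"
  shows "\<exists>p :: nat \<Rightarrow> complex^'n. \<exists>\<mu> :: nat \<Rightarrow> real.
    (\<forall>x. x = (\<Sum>k<CARD('n). cip (p k) x *s p k)) \<and>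
    (\<forall>x. (\<Sum>i\<in>UNIV. \<Sum>j\<in>UNIV. cnj (x $ i) * (A $$ (f i, f j) * x $ j))
      = (\<Sum>k<CARD('n). of_real (\<mu> k * (cmod (cip (p k) x))\<^sup>2))) \<and>
    eigenvalues_mset A = image_mset (\<lambda>k. complex_of_real (\<mu> k)) (mset_set {..<CARD('n)})"
proof -
  let ?N = "CARD('n)"
  define e where "e = inv_into UNIV f"
  have e: "bij_betw e {..<?N} UNIV" unfolding e_def using f by (rule bij_betw_inv_into)
  have fe: "f (e r) = r" if "r < ?N" for r
    unfolding e_def using that f by (intro bij_betw_inv_into_right[of f UNIV "{..<?N}"]) auto
  have fN: "f i < ?N" for i using bij_betw_apply[OF f] by simp
  have reindex: "(\<Sum>r<?N. g (e r)) = (\<Sum>i\<in>UNIV. g i)" for g :: "'n \<Rightarrow> complex"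
    by (rule sum.reindex_bij_betw[OF e])
  define T :: "complex^'n \<Rightarrow> complex^'n" where "T x = (\<chi> i. \<Sum>j\<in>UNIV. A $$ (f i, f j) * x $ j)" for x
  have T: "clinear T"
    by (rule clinearI) (simp_all add: T_def vec_eq_iff sum.distrib sum_distrib_left algebra_simps)
  have self_adjoint: "cip (T x) y = cip x (T y)" for x y
  proof -
    have "cip (T x) y = (\<Sum>i\<in>UNIV. \<Sum>j\<in>UNIV. cnj (A $$ (f i, f j)) * cnj (x $ j) * y $ i)"
      by (simp add: cip_def T_def sum_distrib_right)
    also have "\<dots> = (\<Sum>j\<in>UNIV. \<Sum>i\<in>UNIV. cnj (A $$ (f i, f j)) * cnj (x $ j) * y $ i)" by (rule sum.swap)
    also have "\<dots> = cip x (T y)"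
      by (simp add: cip_def T_def sum_distrib_left mult_ac
          hermitian_index[OF A(2,1) fN fN, symmetric])
    finally show ?thesis .
  qed
  obtain p \<mu> where basis: "\<forall>k<?N. T (p k) = complex_of_real (\<mu> k) *s p k"
    "\<forall>k<?N. \<forall>l<?N. cip (p k) (p l) = (if k = l then 1 else 0)"
    and expand: "\<forall>x. x = (\<Sum>k<?N. cip (p k) x *s p k)"
    and quad: "\<forall>x. cip x (T x) = (\<Sum>k<?N. of_real (\<mu> k * (cmod (cip (p k) x))\<^sup>2))"
    using orthonormal_eigenbasis[OF T self_adjoint] by (elim exE conjE)
  note p = basis(1)[rule_format] basis(2)[rule_format]
  define P where "P = Matrix.mat ?N ?N (\<lambda>(r, k). p k $ e r)"
  define Q where "Q = Matrix.mat ?N ?N (\<lambda>(k, r). cnj (p k $ e r))"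
  define D where "D = Matrix.mat ?N ?N (\<lambda>(k, l). if k = l then complex_of_real (\<mu> k) else 0)"
  have carrier: "P \<in> carrier_mat ?N ?N" "Q \<in> carrier_mat ?N ?N" "D \<in> carrier_mat ?N ?N"
    by (simp_all add: P_def Q_def D_def)
  have QP: "Q * P = 1\<^sub>m ?N"
  proof (rule eq_matI)
    fix k l assume kl: "k < dim_row (1\<^sub>m ?N)" "l < dim_col (1\<^sub>m ?N)"
    then have "(Q * P) $$ (k, l) = (\<Sum>r<?N. cnj (p k $ e r) * p l $ e r)"
      by (simp add: P_def Q_def scalar_prod_def atLeast0LessThan)
    also have "\<dots> = cip (p k) (p l)" unfolding reindex[of "\<lambda>i. cnj (p k $ i) * p l $ i"] cip_def ..
    finally show "(Q * P) $$ (k, l) = 1\<^sub>m ?N $$ (k, l)" using kl p(2) by simp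
  qed (simp_all add: P_def Q_def)
  have PQ: "P * Q = 1\<^sub>m ?N" using carrier(2,1) QP by (rule mat_mult_left_right_inverse)
  have AP: "A * P = P * D"
  proof (rule eq_matI)
    fix r k assume "r < dim_row (P * D)" "k < dim_col (P * D)"
    then have rk: "r < ?N" "k < ?N" by (simp_all add: P_def D_def)
    have "(A * P) $$ (r, k) = (\<Sum>s<?N. A $$ (r, s) * p k $ e s)"
      using rk A(1) by (simp add: P_def scalar_prod_def atLeast0LessThan)
    also have "\<dots> = (\<Sum>s<?N. A $$ (f (e r), f (e s)) * p k $ e s)"
      using rk by (intro sum.cong) (simp_all add: fe)
    also have "\<dots> = T (p k) $ e r"
      unfolding reindex[of "\<lambda>i. A $$ (f (e r), f i) * p k $ i"] by (simp add: T_def)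
    also have "\<dots> = p k $ e r * of_real (\<mu> k)" using rk by (simp add: p(1))
    also have "\<dots> = (\<Sum>l<?N. p l $ e r * (if l = k then of_real (\<mu> l) else 0))"
      using rk by (simp add: if_distrib[of "\<lambda>c. _ * c"] cong: if_cong)
    also have "\<dots> = (P * D) $$ (r, k)"
      using rk by (simp add: P_def D_def scalar_prod_def atLeast0LessThan)
    finally show "(A * P) $$ (r, k) = (P * D) $$ (r, k)" .
  qed (use A in \<open>simp_all add: P_def D_def\<close>)
  have "A = A * (P * Q)" using A(1) PQ by simp
  also have "\<dots> = P * D * Q"
    unfolding AP[symmetric] by (rule assoc_mult_mat[OF A(1) carrier(1,2), symmetric])
  finally have "similar_mat_wit A D P Q" using A(1) carrier PQ QP by (intro similar_mat_witI)
  then have "char_poly A = char_poly D" by (intro char_poly_similar) (auto simp: similar_mat_def)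
  then have eig: "eigenvalues_mset A = image_mset (\<lambda>k. complex_of_real (\<mu> k)) (mset_set {..<?N})"
    using eigenvalues_mset_diagonal[OF D_def] by (simp add: eigenvalues_mset_def)
  have "\<forall>x. (\<Sum>i\<in>UNIV. \<Sum>j\<in>UNIV. cnj (x $ i) * (A $$ (f i, f j) * x $ j))
      = (\<Sum>k<?N. of_real (\<mu> k * (cmod (cip (p k) x))\<^sup>2))"
    unfolding quad[rule_format, symmetric] by (simp add: cip_def T_def sum_distrib_left)
  with expand eig show ?thesis by (intro exI conjI)
qed

lemma inertia_image:
  fixes \<mu> :: "nat \<Rightarrow> real"
  assumes "eigenvalues_mset A = image_mset (\<lambda>k. complex_of_real (\<mu> k)) (mset_set {..<n})"
  shows "inertia A = (card {k. k < n \<and> \<mu> k < 0}, card {k. k < n \<and> \<mu> k = 0}, card {k. k < n \<and> 0 < \<mu> k})"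
  unfolding inertia_def assms by (simp add: filter_mset_image_mset less_complex_def)

lemma psd_index:
  fixes f :: "'n::finite \<Rightarrow> nat"
  assumes f: "bij_betw f UNIV {..<CARD('n)}"
    and A: "A \<in> carrier_mat CARD('n) CARD('n)" "psd A"
  shows "0 \<le> (\<Sum>i\<in>UNIV. \<Sum>j\<in>UNIV. cnj (x $ i) * (A $$ (f i, f j) * x $ j))"
proof -
  let ?N = "CARD('n)"
  define e where "e = inv_into UNIV f"
  have e: "e (f i) = i" for i
    unfolding e_def using f by (intro inv_into_f_f) (auto simp: bij_betw_def)
  have reindex: "(\<Sum>r<?N. g r) = (\<Sum>i\<in>UNIV. g (f i))" for g :: "nat \<Rightarrow> complex"
    by (rule sum.reindex_bij_betw[OF f, symmetric])
  define v where "v = Matrix.vec ?N (\<lambda>r. x $ e r)"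
  have "(A *\<^sub>v v) \<bullet>c v = (\<Sum>r<?N. (\<Sum>s<?N. A $$ (r, s) * x $ e s) * cnj (x $ e r))"
    using A(1) by (simp add: v_def scalar_prod_def atLeast0LessThan conjugate_complex_def)
  also have "\<dots> = (\<Sum>i\<in>UNIV. \<Sum>j\<in>UNIV. cnj (x $ i) * (A $$ (f i, f j) * x $ j))"
    unfolding reindex e by (simp add: sum_distrib_left mult.commute)
  finally have "(A *\<^sub>v v) \<bullet>c v = (\<Sum>i\<in>UNIV. \<Sum>j\<in>UNIV. cnj (x $ i) * (A $$ (f i, f j) * x $ j))" .
  moreover have "v \<in> carrier_vec (dim_row A)" using A(1) by (simp add: v_def)
  then have "0 \<le> (A *\<^sub>v v) \<bullet>c v" using A(2) unfolding psd_def by blast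
  ultimately show ?thesis by simp
qed

section \<open>Partial transposes\<close>

lemma block_index_less:
  fixes a b m n :: nat
  assumes "a < m" "b < n"
  shows "a * n + b < m * n"
proof -
  have "a * n + b < Suc a * n" using assms by simp
  also have "\<dots> \<le> m * n" using assms by (intro mult_le_mono1) simp
  finally show ?thesis .
qed

lemma block_index_bij:
  fixes \<alpha> :: "'m::finite \<Rightarrow> nat" and \<gamma> :: "'n::finite \<Rightarrow> nat"
  assumes \<alpha>: "bij_betw \<alpha> UNIV {..<CARD('m)}" and \<gamma>: "bij_betw \<gamma> UNIV {..<CARD('n)}"
  shows "bij_betw (\<lambda>ij. \<alpha> (fst ij) * CARD('n) + \<gamma> (snd ij)) UNIV {..<CARD('m \<times> 'n)}"
proof -
  let ?f = "\<lambda>ij. \<alpha> (fst ij) * CARD('n) + \<gamma> (snd ij)"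
  have \<gamma>_less: "\<gamma> j < CARD('n)" for j using bij_betw_apply[OF \<gamma>] by simp
  have \<alpha>_less: "\<alpha> i < CARD('m)" for i using bij_betw_apply[OF \<alpha>] by simp
  have "inj ?f"
  proof (rule injI)
    fix x y assume eq: "?f x = ?f y"
    have "?f x div CARD('n) = \<alpha> (fst x)" "?f y div CARD('n) = \<alpha> (fst y)"
      "?f x mod CARD('n) = \<gamma> (snd x)" "?f y mod CARD('n) = \<gamma> (snd y)"
      using \<gamma>_less by simp_all
    with eq have "\<alpha> (fst x) = \<alpha> (fst y)" "\<gamma> (snd x) = \<gamma> (snd y)" by metis+
    then show "x = y" using \<alpha> \<gamma> by (auto simp: bij_betw_def inj_eq prod_eq_iff)
  qed
  moreover have "?f x < CARD('m \<times> 'n)" for x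
    using block_index_less[OF \<alpha>_less \<gamma>_less] by simp
  ultimately show ?thesis
    by (intro bij_betw_imageI card_subset_eq) (auto simp: card_image)
qed

lemma partial_transpose_index:
  assumes "r < m * n" "c < m * n"
  shows "partial_transpose m n M $$ (r, c) = M $$ (c div n * n + r mod n, r div n * n + c mod n)"
proof -
  have "n \<noteq> 0" using assms by (metis mult_0_right not_less0)
  then show ?thesis using assms by (simp add: partial_transpose_def mat_block_def)
qed

lemma hermitian_partial_transpose:
  assumes "M \<in> carrier_mat (m * n) (m * n)" "hermitian M"
  shows "hermitian (partial_transpose m n M)"
proof (rule hermitianI)
  fix r c assume rc: "r < m * n" "c < m * n"
  then have "n \<noteq> 0" by (metis mult_0_right not_less0)
  then have less: "r div n * n + c mod n < m * n" "c div n * n + r mod n < m * n"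
    using rc by (auto intro!: block_index_less simp: less_mult_imp_div_less)
  show "partial_transpose m n M $$ (c, r) = cnj (partial_transpose m n M $$ (r, c))"
    using hermitian_index[OF assms(2,1) less(2,1)]
    by (simp only: partial_transpose_index[OF rc] partial_transpose_index[OF rc(2,1)])
qed (simp add: partial_transpose_def)

text \<open>The quadratic form of the partial transpose at \<open>a \<otimes> b\<close> is that of the matrix itself at
  the product of the conjugate of \<open>a\<close> with \<open>b\<close>.\<close>

lemma partial_transpose_product_nonneg:
  fixes \<alpha> :: "'m::finite \<Rightarrow> nat" and \<gamma> :: "'n::finite \<Rightarrow> nat"
  assumes \<alpha>: "bij_betw \<alpha> UNIV {..<CARD('m)}" and \<gamma>: "bij_betw \<gamma> UNIV {..<CARD('n)}"
    and \<rho>: "\<rho> \<in> carrier_mat (CARD('m) * CARD('n)) (CARD('m) * CARD('n))" "psd \<rho>"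
  defines "f \<equiv> \<lambda>ij. \<alpha> (fst ij) * CARD('n) + \<gamma> (snd ij)"
    and "H \<equiv> partial_transpose CARD('m) CARD('n) \<rho>"
  shows "0 \<le> (\<Sum>i\<in>UNIV. \<Sum>j\<in>UNIV. cnj (tensor a b $ i) * (H $$ (f i, f j) * tensor a b $ j))"
proof -
  have f: "bij_betw f UNIV {..<CARD('m \<times> 'n)}" unfolding f_def by (rule block_index_bij[OF \<alpha> \<gamma>])
  have f_less: "f i < CARD('m) * CARD('n)" for i using bij_betw_apply[OF f] by simp
  have \<gamma>_less: "\<gamma> j < CARD('n)" for j using bij_betw_apply[OF \<gamma>] by simp
  have div_mod: "f i div CARD('n) = \<alpha> (fst i)" "f i mod CARD('n) = \<gamma> (snd i)" for i
    using \<gamma>_less by (simp_all add: f_def)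
  have H: "H $$ (f i, f j) = \<rho> $$ (f (fst j, snd i), f (fst i, snd j))" for i j
    unfolding H_def partial_transpose_index[OF f_less f_less] div_mod by (simp add: f_def)
  let ?y = "tensor (\<chi> i. cnj (a $ i)) b"
  \<comment> \<open>Partial transposition exchanges the first components of the row and column
    index. This exchange is an involution, and it moves entries of \<open>a\<close> to the
    conjugated side and back, hence the conjugate in \<open>?y\<close>.\<close>
  let ?s = "\<lambda>(i, j). ((fst j, snd i), (fst i, snd j))"
  have "(\<Sum>i\<in>UNIV. \<Sum>j\<in>UNIV. cnj (tensor a b $ i) * (H $$ (f i, f j) * tensor a b $ j))
      = (\<Sum>(i, j)\<in>UNIV \<times> UNIV. cnj (tensor a b $ i) * (H $$ (f i, f j) * tensor a b $ j))"
    by (rule sum.cartesian_product)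
  also have "\<dots> = (\<Sum>(i, j)\<in>UNIV \<times> UNIV. cnj (?y $ i) * (\<rho> $$ (f i, f j) * ?y $ j))"
    by (rule sum.reindex_bij_witness[of _ ?s ?s]) (auto simp: H tensor_def mult_ac)
  also have "\<dots> = (\<Sum>i\<in>UNIV. \<Sum>j\<in>UNIV. cnj (?y $ i) * (\<rho> $$ (f i, f j) * ?y $ j))"
    by (rule sum.cartesian_product[symmetric])
  also have "0 \<le> \<dots>" using f \<rho> by (intro psd_index) simp_all
  finally show ?thesis .
qed

text \<open>The number of positive eigenvalues appears as CARD('p) so that the inner products with
  the positive eigenvectors can be the coordinates of \<open>F\<close>. \<open>Z\<close> is spanned
  by the eigenvectors for 0.\<close>

lemma product_kernel_in_null_space:
  fixes \<rho> :: "complex mat"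
  assumes \<rho>: "\<rho> \<in> carrier_mat (CARD('m::finite) * CARD('n::finite)) (CARD('m::finite) * CARD('n::finite))" "psd \<rho>"
    and inertia: "inertia (partial_transpose CARD('m::finite) CARD('n::finite) \<rho>) = (n, z, CARD('p::finite))"
  obtains F :: "complex^('m::finite \<times> 'n::finite) \<Rightarrow> complex^'p::finite" and Z
  where "clinear F" "vec.subspace Z" "vec.dim Z \<le> z" "\<And>a b. F (tensor a b) = 0 \<Longrightarrow> tensor a b \<in> Z"
proof -
  let ?N = "CARD('m \<times> 'n)"
  define H where "H = partial_transpose CARD('m) CARD('n) \<rho>"
  obtain \<alpha> :: "'m \<Rightarrow> nat" where \<alpha>: "bij_betw \<alpha> UNIV {..<CARD('m)}"
    using ex_bij_betw_finite_nat[of "UNIV :: 'm set"] by (auto simp: atLeast0LessThan)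
  obtain \<gamma> :: "'n \<Rightarrow> nat" where \<gamma>: "bij_betw \<gamma> UNIV {..<CARD('n)}"
    using ex_bij_betw_finite_nat[of "UNIV :: 'n set"] by (auto simp: atLeast0LessThan)
  define f where "f ij = \<alpha> (fst ij) * CARD('n) + \<gamma> (snd ij)" for ij
  have f: "bij_betw f UNIV {..<?N}" unfolding f_def by (rule block_index_bij[OF \<alpha> \<gamma>])
  have H: "H \<in> carrier_mat ?N ?N" "hermitian H"
    using \<rho> hermitian_partial_transpose[OF \<rho>(1)] by (simp_all add: H_def partial_transpose_def psd_def)
  obtain p \<mu> where expand: "\<forall>x. x = (\<Sum>k<?N. cip (p k) x *s p k)"
    and quad: "\<forall>x. (\<Sum>i\<in>UNIV. \<Sum>j\<in>UNIV. cnj (x $ i) * (H $$ (f i, f j) * x $ j))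
      = (\<Sum>k<?N. of_real (\<mu> k * (cmod (cip (p k) x))\<^sup>2))"
    and eig: "eigenvalues_mset H = image_mset (\<lambda>k. complex_of_real (\<mu> k)) (mset_set {..<?N})"
    using hermitian_eigenbasis[OF f H] by (elim exE conjE)
  have card: "card {k. k < ?N \<and> \<mu> k = 0} = z" "card {k. k < ?N \<and> 0 < \<mu> k} = CARD('p)"
    using inertia inertia_image[OF eig] by (simp_all add: H_def)
  obtain \<sigma> :: "'p \<Rightarrow> nat" where \<sigma>: "bij_betw \<sigma> UNIV {k. k < ?N \<and> 0 < \<mu> k}"
    using finite_same_card_bij[of "UNIV :: 'p set" "{k. k < ?N \<and> 0 < \<mu> k}"] card(2) by auto
  define F :: "complex^('m \<times> 'n) \<Rightarrow> complex^'p" where "F x = (\<chi> q. cip (p (\<sigma> q)) x)" for x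
  define Z where "Z = vec.span (p ` {k. k < ?N \<and> \<mu> k = 0})"
  have "clinear F" by (rule clinearI) (simp_all add: F_def vec_eq_iff)
  moreover have "vec.subspace Z" unfolding Z_def by (rule vec.subspace_span)
  moreover have "vec.dim Z \<le> z"
  proof -
    have "vec.dim Z \<le> card (p ` {k. k < ?N \<and> \<mu> k = 0})" unfolding Z_def by (rule vec.dim_le_card) auto
    also have "\<dots> \<le> z" unfolding card(1)[symmetric] by (rule card_image_le) simp
    finally show ?thesis .
  qed
  moreover have "tensor a b \<in> Z" if F0: "F (tensor a b) = 0" for a b
  proof -
    let ?x = "tensor a b"
    have pos: "cip (p k) ?x = 0" if k: "k < ?N" "0 < \<mu> k" for k
    proof -
      obtain q where "k = \<sigma> q" using k \<sigma> unfolding bij_betw_def by blast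
      then show ?thesis using F0 by (simp add: F_def vec_eq_iff)
    qed
    \<comment> \<open>The positive eigenvalues contribute nothing at a kernel product, so every
      \<open>t k\<close> is nonnegative, while their sum is at most 0 because the form is
      nonnegative at products. Each \<open>t k\<close> is therefore 0, and the components along
      negative eigenvectors vanish.\<close>
    define t where "t k = - (\<mu> k * (cmod (cip (p k) ?x))\<^sup>2)" for k
    have t_nonneg: "0 \<le> t k" if "k < ?N" for k
      using pos[OF that] by (cases "0 < \<mu> k") (auto simp: t_def mult_nonpos_nonneg)
    have "0 \<le> (\<Sum>k<?N. complex_of_real (\<mu> k * (cmod (cip (p k) ?x))\<^sup>2))"
      using partial_transpose_product_nonneg[OF \<alpha> \<gamma> \<rho>, of a b, folded f_def H_def] unfolding quad[rule_format] .
    also have "\<dots> = complex_of_real (- (\<Sum>k<?N. t k))" by (simp add: t_def sum_negf)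
    finally have "(\<Sum>k<?N. t k) \<le> 0" by (simp add: less_eq_complex_def)
    moreover have "0 \<le> (\<Sum>k<?N. t k)" using t_nonneg by (intro sum_nonneg) simp
    ultimately have "(\<Sum>k<?N. t k) = 0" by simp
    then have t0: "t k = 0" if "k < ?N" for k
      using sum_nonneg_eq_0_iff[of "{..<?N}" t] t_nonneg that by simp
    have "cip (p k) ?x *s p k \<in> Z" if "k < ?N" for k
    proof (cases "\<mu> k = 0")
      case True
      then show ?thesis unfolding Z_def using that by (intro vec.span_scale vec.span_base) simp
    next
      case False
      then have "cip (p k) ?x = 0" using t0[OF that] by (simp add: t_def)
      then show ?thesis unfolding Z_def by (simp add: vec.span_zero)
    qed
    then have "(\<Sum>k<?N. cip (p k) ?x *s p k) \<in> Z" unfolding Z_def by (intro vec.span_sum) simp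
    then show ?thesis unfolding expand[rule_format, of ?x, symmetric] .
  qed
  ultimately show ?thesis by (rule that)
qed

theorem theorem24:
  shows "(6, 2, 4) \<notin> npt_inertias 3 4 \<and> (6, 3, 3) \<notin> npt_inertias 3 4 \<and> (5, 4, 3) \<notin> npt_inertias 3 4"
proof (intro conjI notI)
  assume "(6, 2, 4) \<in> npt_inertias 3 4"
  then obtain \<rho> where \<rho>: "\<rho> \<in> carrier_mat (3 * 4) (3 * 4)" "psd \<rho>"
    "inertia (partial_transpose 3 4 \<rho>) = (6, 2, 4)"
    unfolding npt_inertias_def by auto
  show False
  proof (rule product_kernel_in_null_space[where 'm = 3 and 'n = 4 and 'p = 4, of \<rho> 6 2])
    fix F :: "complex^(3 \<times> 4) \<Rightarrow> complex^4" and Z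
    assume F: "clinear F" "vec.subspace Z" "vec.dim Z \<le> 2"
      and mem: "\<And>a b. F (tensor a b) = 0 \<Longrightarrow> tensor a b \<in> Z"
    have "vec.dim Z < 3" using F(3) by simp
    then obtain a b where "F (tensor a b) = 0" "tensor a b \<notin> Z" by (rule kernel_products_span_3[OF F(1,2)])
    with mem show False by blast
  qed (use \<rho> in simp_all)
next
  \<comment> \<open>The two inertias with three positive eigenvalues share one argument, since both
    have fewer than 5 zero eigenvalues.\<close>
  have no: False if z: "z < 5" and n: "(n, z, 3) \<in> npt_inertias 3 4" for n z
  proof -
    obtain \<rho> where \<rho>: "\<rho> \<in> carrier_mat (3 * 4) (3 * 4)" "psd \<rho>"
      "inertia (partial_transpose 3 4 \<rho>) = (n, z, 3)"
      using n unfolding npt_inertias_def by auto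
    show False
    proof (rule product_kernel_in_null_space[where 'm = 3 and 'n = 4 and 'p = 3, of \<rho> n z])
      fix F :: "complex^(3 \<times> 4) \<Rightarrow> complex^3" and Z
      assume F: "clinear F" "vec.subspace Z" "vec.dim Z \<le> z"
        and mem: "\<And>a b. F (tensor a b) = 0 \<Longrightarrow> tensor a b \<in> Z"
      have "vec.dim Z < 5" using F(3) z by simp
      then obtain a b where "F (tensor a b) = 0" "tensor a b \<notin> Z" by (rule kernel_products_span_5[OF F(1,2)])
      with mem show False by blast
    qed (use \<rho> in simp_all)
  qed
  show "(6, 3, 3) \<in> npt_inertias 3 4 \<Longrightarrow> False" "(5, 4, 3) \<in> npt_inertias 3 4 \<Longrightarrow> False"
    \<comment> \<open>The number of zero eigenvalues comes before the number of negative ones in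
      these instantiations.\<close>
    using no[of 3 6] no[of 4 5] by simp_all
qed

end
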